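(* Let $0<p<1/2$. a) The maximal operator $$\widetilde\sigma_p^{*}f:=\sup_{n\in\mathbb N_+}\frac{|\sigma_nf|}{(n+1)^{1/p-2}}$$ is bounded from the martingale Hardy space $H_p$ to the Lebesgue space $L_p$. b) Let $\{\Phi_n:n\in\mathbb N\}$ be any non-decreasing sequence of positive numbers satisfying $$\limsup_{n\to\infty}\frac{(n+1)^{1/p-2}}{\Phi_n}=+\infty .$$ Then there exists a sequence $\{n_k:k\in\mathbb N\}$ of positive integers such that, with $f_k:=D_{M_{2n_k+1}}-D_{M_{2n_k}}$, $$\sup_{k\in\mathbb N}\frac{\left\|\dfrac{\sigma_{M_{2n_k}+1}f_k}{\Phi_{M_{2n_k}+1}}\right\|_{weak-L_p}}{\|f_k\|_{H_p}}=\infty .$$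
   Context: $\mathbb N_+$ is the set of positive integers, $\mathbb N=\mathbb N_+\cup\{0\}$. Fix a bounded sequence $m=(m_0,m_1,\dots)$ of integers $m_k\ge 2$. $G_m=\prod_{k\ge0}Z_{m_k}$, where $Z_{m_k}=\{0,\dots,m_k-1\}$ is the additive group modulo $m_k$, with the product of the discrete topologies; $\mu$ is the Haar measure with $\mu(G_m)=1$. $M_0:=1$, $M_{k+1}:=m_kM_k$; every $n\in\mathbb N$ is uniquely $n=\sum_{j\ge0}n_jM_j$ with $n_j\in Z_{m_j}$. $r_k(x):=\exp(2\pi i x_k/m_k)$, $\psi_n:=\prod_{k\ge0}r_k^{n_k}$ (Vilenkin system), $D_n:=\sum_{k=0}^{n-1}\psi_k$. $I_0(x):=G_m$, $I_n(x):=\{y: y_0=x_0,\dots,y_{n-1}=x_{n-1}\}$; $\mathcal F_n$ is the $\sigma$-algebra generated by $\{I_n(x):x\in G_m\}$. For $g\in L_1(G_m)$: $\widehat g(k):=\int g\overline{\psi_k}\,d\mu$, $S_ng:=\sum_{k=0}^{n-1}\widehat g(k)\psi_k$. A martingale is a sequence $f=(f^{(n)}:n\in\mathbb N)$ of integrable functions with $f^{(n)}$ $\mathcal F_n$-measurable and $S_{M_n}f^{(k)}=f^{(n)}$ for $n\le k$; $f^*:=\sup_n|f^{(n)}|$; $H_p$ is the set of martingales with $\|f\|_{H_p}:=\|f^*\|_p<\infty$, where $\|g\|_p:=(\int|g|^pd\mu)^{1/p}$. For a martingale, $\widehat f(i):=\lim_k\int f^{(k)}\overline{\psi_i}\,d\mu$,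 $S_nf:=\sum_{k=0}^{n-1}\widehat f(k)\psi_k$, and $\sigma_nf:=\frac1n\sum_{k=1}^nS_kf$ ($n\in\mathbb N_+$). A function $g\in L_1$ is identified with the martingale $(S_{M_n}g:n\in\mathbb N)$, so $\|g\|_{H_p}=\|\sup_n|S_{M_n}g|\|_p$. $\|g\|_{weak-L_p}:=\sup_{\lambda>0}\lambda\,\mu(|g|>\lambda)^{1/p}$. An operator $T$ is bounded from $H_p$ to $L_p$ if there is a constant $C$ with $\|Tf\|_p\le C\|f\|_{H_p}$ for all $f\in H_p$. *)

theory Defs
  imports "HOL-Probability.Probability"
begin

section \<open>The Vilenkin group and its Haar measure\<close>

definition vil_group :: "(nat \<Rightarrow> nat) \<Rightarrow> (nat \<Rightarrow> nat) set" where
  "vil_group m = (\<Pi>\<^sub>E k\<in>UNIV. {..<m k})"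

definition vil_add :: "(nat \<Rightarrow> nat) \<Rightarrow> (nat \<Rightarrow> nat) \<Rightarrow> (nat \<Rightarrow> nat) \<Rightarrow> nat \<Rightarrow> nat" where
  "vil_add m x y = (\<lambda>k. (x k + y k) mod m k)"

text \<open>
  The normalised Haar measure is the product of the uniform probability measures on the
  factors. The lemmas \<open>sets_vil_measure\<close>, \<open>emeasure_vil_measure_space\<close> and
  \<open>vil_measure_invariant\<close> show that it is indeed the translation-invariant probability
  measure on the Borel sets of the product topology.
\<close>

definition vil_measure :: "(nat \<Rightarrow> nat) \<Rightarrow> (nat \<Rightarrow> nat) measure" where
  "vil_measure m = (\<Pi>\<^sub>M k\<in>UNIV. uniform_count_measure {..<m k})"

lemma space_vil_measure: "space (vil_measure m) = vil_group m"
  by (simp add: vil_measure_def vil_group_def space_PiM space_uniform_count_measure)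

lemma sets_vil_measure: "sets (vil_measure m) = sets (restrict_space borel (vil_group m))"
proof (intro equalityI subsetI)
  fix A assume A: "A \<in> sets (vil_measure m)"
  have "(\<lambda>x. x) \<in> measurable (restrict_space (borel :: (nat \<Rightarrow> nat) measure) (vil_group m)) (vil_measure m)"
    unfolding vil_measure_def
  proof (rule measurable_PiM_single')
    fix k :: nat
    have "(\<lambda>x :: nat \<Rightarrow> nat. x k) \<in> measurable borel borel"
      using measurable_component_singleton[of k UNIV "\<lambda>_. borel :: nat measure"]
      by (simp cong: measurable_cong_sets add: sets_PiM_equal_borel)
    moreover have "sets (borel :: nat measure) = sets (count_space UNIV)"
      by (rule sets_borel_eq_count_space)
    ultimately have "(\<lambda>x :: nat \<Rightarrow> nat. x k) \<in> measurable borel (count_space UNIV)"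
      using measurable_cong_sets[OF refl] by blast
    then have "(\<lambda>x. x k) \<in> measurable (restrict_space (borel :: (nat \<Rightarrow> nat) measure) (vil_group m))
        (count_space UNIV)"
      by (rule measurable_restrict_space1)
    then have "(\<lambda>x. x k) \<in> measurable (restrict_space (borel :: (nat \<Rightarrow> nat) measure) (vil_group m))
        (restrict_space (count_space UNIV) {..<m k})"
      by (rule measurable_restrict_space2[rotated])
         (auto simp: space_restrict_space vil_group_def)
    then show "(\<lambda>x. x k) \<in> measurable (restrict_space (borel :: (nat \<Rightarrow> nat) measure) (vil_group m))
        (uniform_count_measure {..<m k})"
      by (subst measurable_cong_sets[OF refl, of _ "restrict_space (count_space UNIV) {..<m k}"])
         (auto simp: restrict_count_space sets_uniform_count_measure)
  qed (auto simp: space_restrict_space vil_group_def space_uniform_count_measure)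
  from measurable_sets[OF this A]
  have "A \<inter> vil_group m \<in> sets (restrict_space borel (vil_group m))"
    by (simp add: space_restrict_space)
  moreover have "A \<subseteq> vil_group m"
    using sets.sets_into_space[OF A] by (simp add: space_vil_measure)
  ultimately show "A \<in> sets (restrict_space borel (vil_group m))"
    by (simp add: Int_absorb2)
next
  fix A assume "A \<in> sets (restrict_space borel (vil_group m))"
  then obtain B :: "(nat \<Rightarrow> nat) set" where B: "B \<in> sets borel" and A: "A = vil_group m \<inter> B"
    by (auto simp: sets_restrict_space)
  have "(\<lambda>x. x) \<in> measurable (vil_measure m) (\<Pi>\<^sub>M k\<in>UNIV. (borel :: nat measure))"
  proof (rule measurable_PiM_single')
    fix k :: nat
    have 1: "(\<lambda>x. x k) \<in> measurable (vil_measure m) (uniform_count_measure {..<m k})"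
      unfolding vil_measure_def by (rule measurable_component_singleton) simp
    have 2: "(\<lambda>n. n) \<in> measurable (uniform_count_measure {..<m k}) (borel :: nat measure)"
      by (simp add: measurable_def sets_uniform_count_measure space_uniform_count_measure)
    show "(\<lambda>x. x k) \<in> measurable (vil_measure m) (borel :: nat measure)"
      using measurable_comp[OF 1 2] by (simp add: comp_def)
  qed auto
  moreover have "B \<in> sets (\<Pi>\<^sub>M k\<in>UNIV. (borel :: nat measure))"
    using B by (simp add: sets_PiM_equal_borel)
  ultimately have "(\<lambda>x. x) -` B \<inter> space (vil_measure m) \<in> sets (vil_measure m)"
    by (rule measurable_sets)
  then show "A \<in> sets (vil_measure m)"
    by (simp add: A space_vil_measure Int_commute)
qed

lemma prob_space_uniform_digit:
  assumes "0 < n" shows "prob_space (uniform_count_measure {..<n :: nat})"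
  using assms by (intro prob_space_uniform_count_measure) auto

lemma emeasure_vil_measure_space:
  assumes "\<And>k. 2 \<le> m k"
  shows "emeasure (vil_measure m) (vil_group m) = 1"
proof -
  have "0 < m k" for k using assms[of k] by simp
  then have "prob_space (vil_measure m)"
    unfolding vil_measure_def by (intro prob_space_PiM prob_space_uniform_digit)
  then show ?thesis
    using prob_space.emeasure_space_1 space_vil_measure by metis
qed

lemma distr_uniform_digit_add:
  assumes n: "0 < n" and c: "c < n"
  shows "distr (uniform_count_measure {..<n}) (uniform_count_measure {..<n}) (\<lambda>a. (a + c) mod n)
    = uniform_count_measure {..<n :: nat}" (is "distr ?U ?U ?t = _")
proof (rule measure_eqI)
  have t: "?t \<in> measurable ?U ?U"
    using n by (auto simp: measurable_def sets_uniform_count_measure space_uniform_count_measure)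
  have inj: "inj_on ?t {..<n}"
  proof (rule inj_onI)
    fix a b assume "a \<in> {..<n}" "b \<in> {..<n}" "(a + c) mod n = (b + c) mod n"
    then show "a = b"
      using c by (auto simp: mod_if split: if_splits)
  qed
  have img: "?t ` {..<n} = {..<n}"
    using n by (intro card_subset_eq) (auto simp: card_image[OF inj])
  fix A assume "A \<in> sets (distr ?U ?U ?t)"
  then have A: "A \<subseteq> {..<n}" by (simp add: sets_uniform_count_measure)
  have "?t ` (?t -` A \<inter> {..<n}) = A"
  proof (intro equalityI subsetI)
    fix x assume x: "x \<in> A"
    then have "x \<in> ?t ` {..<n}" using A img by blast
    then show "x \<in> ?t ` (?t -` A \<inter> {..<n})" using x by auto
  qed auto
  then have "card (?t -` A \<inter> {..<n}) = card A"
    using card_image[OF inj_on_subset[OF inj, of "?t -` A \<inter> {..<n}"]] by auto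
  then show "emeasure (distr ?U ?U ?t) A = emeasure ?U A"
    using A t by (subst emeasure_distr)
      (auto simp: sets_uniform_count_measure space_uniform_count_measure emeasure_uniform_count_measure)
qed simp

lemma vil_measure_invariant:
  assumes m: "\<And>k. 2 \<le> m k" and y: "y \<in> vil_group m"
  shows "distr (vil_measure m) (vil_measure m) (\<lambda>x. vil_add m x y) = vil_measure m"
proof -
  let ?U = "\<lambda>k. uniform_count_measure {..<m k}"
  let ?T = "\<lambda>x. vil_add m x y"
  have pos: "0 < m k" for k using m[of k] by simp
  interpret P: product_prob_space ?U UNIV
    by (intro product_prob_spaceI prob_space_uniform_digit pos)
  have digit: "(\<lambda>a. (a + y k) mod m k) \<in> measurable (?U k) (?U k)" for k
    using pos[of k]
    by (auto simp: measurable_def sets_uniform_count_measure space_uniform_count_measure)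
  have T: "?T \<in> measurable (vil_measure m) (vil_measure m)"
    unfolding vil_measure_def
  proof (rule measurable_PiM_single')
    fix k :: nat
    show "(\<lambda>x. vil_add m x y k) \<in> measurable (Pi\<^sub>M UNIV ?U) (?U k)"
      unfolding vil_add_def
      using measurable_comp[OF measurable_component_singleton[of k UNIV ?U] digit[of k]]
      by (simp add: comp_def)
  qed (use pos in \<open>auto simp: space_PiM space_uniform_count_measure vil_add_def\<close>)
  have "distr (vil_measure m) (vil_measure m) ?T = Pi\<^sub>M UNIV ?U"
  proof (rule P.PiM_eq)
    fix J F assume J: "finite J" and F: "\<And>j. j \<in> J \<Longrightarrow> F j \<in> sets (?U j)"
    let ?F = "\<lambda>j. (\<lambda>a. (a + y j) mod m j) -` F j \<inter> {..<m j}"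
    have pre: "?F j \<in> sets (?U j)" for j
      by (simp add: sets_uniform_count_measure)
    have "?T -` prod_emb UNIV ?U J (Pi\<^sub>E J F) \<inter> space (vil_measure m)
        = prod_emb UNIV ?U J (Pi\<^sub>E J ?F)"
      using pos
      by (fastforce simp: prod_emb_def space_vil_measure vil_group_def vil_add_def PiE_iff
          space_uniform_count_measure restrict_def extensional_def)
    moreover have "prod_emb UNIV ?U J (Pi\<^sub>E J F) \<in> sets (vil_measure m)"
      unfolding vil_measure_def using J F by (intro sets_PiM_I) auto
    ultimately have "emeasure (distr (vil_measure m) (vil_measure m) ?T) (prod_emb UNIV ?U J (Pi\<^sub>E J F))
        = emeasure (Pi\<^sub>M UNIV ?U) (prod_emb UNIV ?U J (Pi\<^sub>E J ?F))"
      by (simp add: emeasure_distr[OF T]) (simp add: vil_measure_def)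
    also have "\<dots> = (\<Prod>j\<in>J. emeasure (?U j) (?F j))"
      by (intro P.emeasure_PiM_emb J pre) auto
    also have "\<dots> = (\<Prod>j\<in>J. emeasure (?U j) (F j))"
    proof (rule prod.cong[OF refl])
      fix j assume "j \<in> J"
      have "y j < m j" using y by (auto simp: vil_group_def)
      from distr_uniform_digit_add[OF pos this]
      have "emeasure (?U j) (F j) = emeasure (distr (?U j) (?U j) (\<lambda>a. (a + y j) mod m j)) (F j)"
        by simp
      also have "\<dots> = emeasure (?U j) (?F j)"
        using emeasure_distr[OF digit F[OF \<open>j \<in> J\<close>]] by (simp add: space_uniform_count_measure)
      finally show "emeasure (?U j) (?F j) = emeasure (?U j) (F j)" by simp
    qed
    finally show "emeasure (distr (vil_measure m) (vil_measure m) ?T) (prod_emb UNIV ?U J (Pi\<^sub>E J F))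
        = (\<Prod>j\<in>J. emeasure (?U j) (F j))" .
  qed (simp add: vil_measure_def)
  then show ?thesis by (simp add: vil_measure_def)
qed

definition vil_cylinder :: "(nat \<Rightarrow> nat) \<Rightarrow> nat \<Rightarrow> (nat \<Rightarrow> nat) \<Rightarrow> (nat \<Rightarrow> nat) set" where
  "vil_cylinder m n x = {y \<in> vil_group m. \<forall>i<n. y i = x i}"

definition vil_filtration :: "(nat \<Rightarrow> nat) \<Rightarrow> nat \<Rightarrow> (nat \<Rightarrow> nat) measure" where
  "vil_filtration m n = sigma (vil_group m) (vil_cylinder m n ` vil_group m)"

section \<open>The Vilenkin system\<close>

definition vil_M :: "(nat \<Rightarrow> nat) \<Rightarrow> nat \<Rightarrow> nat" where
  "vil_M m k = (\<Prod>j<k. m j)"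

lemma vil_M_rec: "vil_M m 0 = 1" "vil_M m (Suc k) = m k * vil_M m k"
  by (simp_all add: vil_M_def mult.commute)

text \<open>
  The digit \<open>n\<^sub>j\<close> in the expansion \<open>n = (\<Sum>j. n\<^sub>j M\<^sub>j)\<close>, \<open>0 \<le> n\<^sub>j < m\<^sub>j\<close>;
  see \<open>vil_digit_expansion\<close> and \<open>vil_digit_unique\<close>.
\<close>

definition vil_digit :: "(nat \<Rightarrow> nat) \<Rightarrow> nat \<Rightarrow> nat \<Rightarrow> nat" where
  "vil_digit m n j = n div vil_M m j mod m j"

lemma vil_M_ge_power:
  assumes "\<And>k. 2 \<le> m k" shows "2 ^ k \<le> vil_M m k"
proof (induction k)
  case (Suc k)
  then show ?case using mult_mono[OF assms[of k] Suc] by (simp add: vil_M_rec)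
qed (simp add: vil_M_rec)

lemma vil_digit_expansion:
  assumes m: "\<And>k. 2 \<le> m k"
  shows "vil_digit m n j < m j" and "finite {j. vil_digit m n j \<noteq> 0}"
    and "n = (\<Sum>j | vil_digit m n j \<noteq> 0. vil_digit m n j * vil_M m j)"
proof -
  show "vil_digit m n j < m j"
    using m[of j] by (simp add: vil_digit_def)
  have big: "n < vil_M m j" if "n \<le> j" for j
    using vil_M_ge_power[of m j, OF m] less_exp[of j] that by linarith
  then have sub: "{j. vil_digit m n j \<noteq> 0} \<subseteq> {..<n}"
  proof (intro subsetI)
    fix j assume "j \<in> {j. vil_digit m n j \<noteq> 0}"
    then show "j \<in> {..<n}"
      using big[of j] by (cases "n \<le> j") (auto simp: vil_digit_def)
  qed
  then show "finite {j. vil_digit m n j \<noteq> 0}"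
    by (rule finite_subset) simp
  have "n mod vil_M m k = (\<Sum>j<k. vil_digit m n j * vil_M m j)" for k
  proof (induction k)
    case (Suc k)
    have "n mod vil_M m (Suc k) = vil_M m k * (n div vil_M m k mod m k) + n mod vil_M m k"
      by (simp add: vil_M_rec mult.commute[of "m k"] mod_mult2_eq)
    then show ?case using Suc by (simp add: vil_digit_def mult.commute)
  qed (simp add: vil_M_rec)
  from this[of n] big[of n] have "n = (\<Sum>j<n. vil_digit m n j * vil_M m j)"
    by simp
  also have "\<dots> = (\<Sum>j | vil_digit m n j \<noteq> 0. vil_digit m n j * vil_M m j)"
    using sub by (intro sum.mono_neutral_right) auto
  finally show "n = (\<Sum>j | vil_digit m n j \<noteq> 0. vil_digit m n j * vil_M m j)" .
qed

lemma vil_digit_unique: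
  assumes d: "\<And>j. d j < m j" and "finite {j. d j \<noteq> 0}"
    and n: "n = (\<Sum>j | d j \<noteq> 0. d j * vil_M m j)"
  shows "d j = vil_digit m n j"
proof -
  have M0: "0 < vil_M m k" for k
    unfolding vil_M_def using d by (intro prod_pos) (metis gr_zeroI not_less_zero)
  have low: "(\<Sum>i<k. d i * vil_M m i) < vil_M m k" for k
  proof (induction k)
    case (Suc k)
    have "(\<Sum>i<Suc k. d i * vil_M m i) < (d k + 1) * vil_M m k"
      using Suc by (simp add: algebra_simps)
    also have "\<dots> \<le> vil_M m (Suc k)"
      using d[of k] unfolding vil_M_rec by (intro mult_right_mono) auto
    finally show ?case .
  qed (simp add: vil_M_rec)
  have dvd: "vil_M m a dvd vil_M m b" if "a \<le> b" for a b
    unfolding vil_M_def using that by (intro prod_dvd_prod_subset) auto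
  from assms(2) obtain N where N: "{j. d j \<noteq> 0} \<subseteq> {..<N}"
    using finite_nat_iff_bounded by blast
  define K where "K = max N (Suc j)"
  have "n = (\<Sum>i<K. d i * vil_M m i)"
    unfolding n using N by (intro sum.mono_neutral_left) (auto simp: K_def)
  also have "{..<K} = {..<j} \<union> {j} \<union> {Suc j..<K}"
    by (auto simp: K_def)
  also have "(\<Sum>i\<in>\<dots>. d i * vil_M m i) = (\<Sum>i<j. d i * vil_M m i) + d j * vil_M m j
      + (\<Sum>i=Suc j..<K. d i * vil_M m i)"
    by (subst sum.union_disjoint; auto)+
  finally have split: "n = \<dots>" .
  have "vil_M m (Suc j) dvd (\<Sum>i=Suc j..<K. d i * vil_M m i)"
    by (intro dvd_sum dvd_mult dvd) auto
  then obtain q where "(\<Sum>i=Suc j..<K. d i * vil_M m i) = vil_M m (Suc j) * q" ..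
  then have "n = (\<Sum>i<j. d i * vil_M m i) + vil_M m j * (d j + m j * q)"
    using split by (simp add: vil_M_rec algebra_simps)
  then have "n div vil_M m j = d j + m j * q"
    using low[of j] M0[of j] by simp
  then show ?thesis
    using d[of j] by (simp add: vil_digit_def)
qed

definition vil_r :: "(nat \<Rightarrow> nat) \<Rightarrow> nat \<Rightarrow> (nat \<Rightarrow> nat) \<Rightarrow> complex" where
  "vil_r m k x = exp (2 * of_real pi * \<i> * of_nat (x k) / of_nat (m k))"

definition vil_psi :: "(nat \<Rightarrow> nat) \<Rightarrow> nat \<Rightarrow> (nat \<Rightarrow> nat) \<Rightarrow> complex" where
  "vil_psi m n x = (\<Prod>k | vil_digit m n k \<noteq> 0. vil_r m k x ^ vil_digit m n k)"

definition vil_D :: "(nat \<Rightarrow> nat) \<Rightarrow> nat \<Rightarrow> (nat \<Rightarrow> nat) \<Rightarrow> complex" where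
  "vil_D m n x = (\<Sum>k<n. vil_psi m k x)"

definition vil_coeff :: "(nat \<Rightarrow> nat) \<Rightarrow> ((nat \<Rightarrow> nat) \<Rightarrow> complex) \<Rightarrow> nat \<Rightarrow> complex" where
  "vil_coeff m g k = (\<integral>x. g x * cnj (vil_psi m k x) \<partial>vil_measure m)"

definition vil_S :: "(nat \<Rightarrow> nat) \<Rightarrow> nat \<Rightarrow> ((nat \<Rightarrow> nat) \<Rightarrow> complex) \<Rightarrow> (nat \<Rightarrow> nat) \<Rightarrow> complex" where
  "vil_S m n g x = (\<Sum>k<n. vil_coeff m g k * vil_psi m k x)"

section \<open>Quasi-norms\<close>

definition ennpowr :: "ennreal \<Rightarrow> real \<Rightarrow> ennreal" where
  "ennpowr a p = (if a = \<top> then \<top> else ennreal (enn2real a powr p))"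

text \<open>
  Maximal functions may take the value \<open>\<infinity>\<close>, so the \<open>L\<^sub>p\<close> quasi-norm is defined on
  \<^typ>\<open>ennreal\<close>-valued functions, to be read as \<open>\<bar>g\<bar>\<close>. The exponent is meant to be positive.
\<close>

definition lp_norm :: "'a measure \<Rightarrow> real \<Rightarrow> ('a \<Rightarrow> ennreal) \<Rightarrow> ennreal" where
  "lp_norm M p g = ennpowr (\<integral>\<^sup>+ x. ennpowr (g x) p \<partial>M) (1 / p)"

definition weak_lp_norm :: "'a measure \<Rightarrow> real \<Rightarrow> ('a \<Rightarrow> complex) \<Rightarrow> ennreal" where
  "weak_lp_norm M p g =
     (SUP l\<in>{0<..}. ennreal l * ennpowr (emeasure M {x \<in> space M. l < norm (g x)}) (1 / p))"

section \<open>Martingales, Hardy spaces and Fejer means\<close>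

type_synonym vil_process = "nat \<Rightarrow> (nat \<Rightarrow> nat) \<Rightarrow> complex"

definition vil_martingale :: "(nat \<Rightarrow> nat) \<Rightarrow> vil_process \<Rightarrow> bool" where
  "vil_martingale m f \<longleftrightarrow>
     (\<forall>n. integrable (vil_measure m) (f n)) \<and>
     (\<forall>n. f n \<in> borel_measurable (vil_filtration m n)) \<and>
     (\<forall>n k. n \<le> k \<longrightarrow> (\<forall>x\<in>vil_group m. vil_S m (vil_M m n) (f k) x = f n x))"

definition martingale_of :: "(nat \<Rightarrow> nat) \<Rightarrow> ((nat \<Rightarrow> nat) \<Rightarrow> complex) \<Rightarrow> vil_process" where
  "martingale_of m g = (\<lambda>n. vil_S m (vil_M m n) g)"

definition mart_maximal :: "vil_process \<Rightarrow> (nat \<Rightarrow> nat) \<Rightarrow> ennreal" where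
  "mart_maximal f x = (SUP n. ennreal (norm (f n x)))"

definition hardy_norm :: "(nat \<Rightarrow> nat) \<Rightarrow> real \<Rightarrow> vil_process \<Rightarrow> ennreal" where
  "hardy_norm m p f = lp_norm (vil_measure m) p (mart_maximal f)"

definition hardy_space :: "(nat \<Rightarrow> nat) \<Rightarrow> real \<Rightarrow> vil_process set" where
  "hardy_space m p = {f. vil_martingale m f \<and> hardy_norm m p f < \<top>}"

definition mart_coeff :: "(nat \<Rightarrow> nat) \<Rightarrow> vil_process \<Rightarrow> nat \<Rightarrow> complex" where
  "mart_coeff m f i = lim (\<lambda>k. vil_coeff m (f k) i)"

definition mart_S :: "(nat \<Rightarrow> nat) \<Rightarrow> nat \<Rightarrow> vil_process \<Rightarrow> (nat \<Rightarrow> nat) \<Rightarrow> complex" where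
  "mart_S m n f x = (\<Sum>k<n. mart_coeff m f k * vil_psi m k x)"

definition mart_sigma :: "(nat \<Rightarrow> nat) \<Rightarrow> nat \<Rightarrow> vil_process \<Rightarrow> (nat \<Rightarrow> nat) \<Rightarrow> complex" where
  "mart_sigma m n f x = (\<Sum>k=1..n. mart_S m k f x) / of_nat n"

definition weighted_maximal ::
    "(nat \<Rightarrow> nat) \<Rightarrow> real \<Rightarrow> vil_process \<Rightarrow> (nat \<Rightarrow> nat) \<Rightarrow> ennreal" where
  "weighted_maximal m p f x =
     (SUP n\<in>{1..}. ennreal (norm (mart_sigma m n f x) / (real n + 1) powr (1 / p - 2)))"

definition bounded_hardy_to_lp ::
    "(nat \<Rightarrow> nat) \<Rightarrow> real \<Rightarrow> (vil_process \<Rightarrow> (nat \<Rightarrow> nat) \<Rightarrow> ennreal) \<Rightarrow> bool" where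
  "bounded_hardy_to_lp m p T \<longleftrightarrow>
     (\<exists>C\<ge>0. \<forall>f\<in>hardy_space m p. lp_norm (vil_measure m) p (T f) \<le> ennreal C * hardy_norm m p f)"

end

theory Submission
  imports Defs
begin

text \<open>
  a) Put \<open>K(x, y) = \<Sum>\<^bsub>k\<le>n\<^esub> D\<^sub>k(x - y)\<close>, so that \<open>n \<sigma>\<^sub>n f(x) = \<integral> f\<^sup>(\<^sup>A\<^sup>)(y) K(x, y) dy\<close> for any
  \<open>A\<close> with \<open>n \<le> M\<^sub>A\<close>; choose it with \<open>M\<^sub>A \<le> B n\<close>, \<open>B = sup\<^sub>k m\<^sub>k\<close>. If \<open>x\<close> and \<open>y\<close> first differ in the digits
  \<open>s < t\<close>, cancellation over full blocks of characters gives \<open>\<bar>K(x, y)\<bar> \<le> 2 M\<^bsub>s+1\<^esub> M\<^bsub>t+1\<^esub>\<close>,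
  uniformly in \<open>n\<close>, and the \<open>p\<close>-th power of this bound is integrable in \<open>x\<close> because \<open>p < 1/2\<close>.
  The integrand is constant on cylinders of measure \<open>1 / M\<^sub>A\<close>, and for such functions
  \<open>(\<integral>\<bar>g\<bar>)\<^sup>p \<le> M\<^sub>A\<^bsup>1-p\<^esup> \<integral>\<bar>g\<bar>\<^sup>p\<close>. The factor \<open>M\<^sub>A\<^bsup>1-p\<^esup>\<close> is exactly what the weight \<open>(n+1)\<^bsup>1/p-2\<^esup>\<close>
  absorbs, so the \<open>p\<close>-th power of the maximal operator is at most a constant times
  \<open>\<integral> f\<^sup>*(y)\<^sup>p W(x, y) dy\<close> with \<open>sup\<^sub>y \<integral> W(x, y) dx < \<infinity>\<close>; Tonelli's theorem concludes.
  No atomic decomposition is needed.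

  b) With \<open>N = 2 n\<^sub>k\<close>, \<open>\<sigma>\<^bsub>M\<^sub>N+1\<^esub> f\<^sub>k = \<psi>\<^bsub>M\<^sub>N\<^esub> / (M\<^sub>N + 1)\<close> has constant modulus, while \<open>f\<^sub>k\<close> is bounded
  by \<open>M\<^bsub>N+1\<^esub>\<close> and lives on \<open>I\<^sub>N(0)\<close>; the quotient is at least a constant times
  \<open>M\<^sub>N\<^bsup>1/p-2\<^esup> / \<Phi>\<^bsub>M\<^sub>N+1\<^esub>\<close>.
\<close>

section \<open>Powers of extended nonnegative reals\<close>

lemma ennpowr_ennreal: "0 \<le> r \<Longrightarrow> ennpowr (ennreal r) p = ennreal (r powr p)"
  by (simp add: ennpowr_def)

lemma ennpowr_top [simp]: "ennpowr \<top> p = \<top>"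
  by (simp add: ennpowr_def)

lemma ennpowr_mono:
  assumes "0 \<le> p" "a \<le> b"
  shows "ennpowr a p \<le> ennpowr b p"
proof (cases b)
  case (real r)
  then show ?thesis
    using assms by (cases a) (auto simp: ennpowr_ennreal top_unique intro!: powr_mono2 ennreal_leI)
qed (use assms in \<open>simp add: top_unique\<close>)

lemma ennpowr_ennpowr_inverse:
  assumes "0 < p"
  shows "ennpowr (ennpowr a (1 / p)) p = a"
  using assms by (cases a) (simp_all add: ennpowr_ennreal powr_powr)

text \<open>The power \<open>p\<close> is an order isomorphism with inverse power
  \<open>1 / p\<close>, so a bound passes through the supremum. This reduces maximal functions to a
  single index.\<close>

lemma ennpowr_SUP_le:
  assumes "0 < p" "\<And>i. i \<in> I \<Longrightarrow> ennpowr (f i) p \<le> c"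
  shows "ennpowr (SUP i\<in>I. f i) p \<le> c"
proof -
  have inv: "ennpowr (ennpowr a p) (1 / p) = a" for a
    using ennpowr_ennpowr_inverse[of "1 / p" a] assms(1) by simp
  have "f i \<le> ennpowr c (1 / p)" if "i \<in> I" for i
    using ennpowr_mono[of "1 / p", OF _ assms(2)[OF that]] assms(1) by (simp add: inv)
  then have "(SUP i\<in>I. f i) \<le> ennpowr c (1 / p)" by (rule SUP_least)
  from ennpowr_mono[OF _ this, of p] show ?thesis
    using assms(1) by (simp add: ennpowr_ennpowr_inverse)
qed

lemma ennpowr_mult_ennreal:
  assumes "0 < c" "0 < q"
  shows "ennpowr (ennreal c * a) q = ennreal (c powr q) * ennpowr a q"
proof (cases a)
  case (real r)
  then show ?thesis
    using assms by (simp add: ennreal_mult[symmetric] ennpowr_ennreal powr_mult)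
qed (use assms in \<open>simp add: ennreal_mult_top\<close>)

lemma inverse_antimono_ennreal:
  fixes a b :: ennreal
  assumes "a \<le> b"
  shows "inverse b \<le> inverse a"
proof (cases "a = 0 \<or> b = \<top>")
  case False
  then obtain r s where "a = ennreal r" "b = ennreal s" "0 < r" "0 \<le> s"
    using assms by (cases a; cases b) (auto simp: top_unique less_le)
  then show ?thesis
    using assms by (simp add: inverse_ennreal ennreal_leI le_imp_inverse_le)
qed auto

lemma measurable_ennpowr [measurable]:
  assumes [measurable]: "f \<in> borel_measurable N"
  shows "(\<lambda>x. ennpowr (f x) p) \<in> borel_measurable N"
  unfolding ennpowr_def by measurable

section \<open>Characters and block cancellation\<close>

lemma sum_block:
  fixes f :: "nat \<Rightarrow> 'a::comm_monoid_add"
  shows "(\<Sum>k<q * L + r. f k) = (\<Sum>c<q. \<Sum>j<L. f (c * L + j)) + (\<Sum>j<r. f (q * L + j))"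
proof -
  have shift: "(\<Sum>k<a + b. f k) = (\<Sum>k<a. f k) + (\<Sum>j<b. f (a + j))" for a b
    by (induction b) (auto simp: add.assoc)
  have "(\<Sum>k<q * L. f k) = (\<Sum>c<q. \<Sum>j<L. f (c * L + j))"
  proof (induction q)
    case (Suc q)
    have "(\<Sum>k<Suc q * L. f k) = (\<Sum>k<q * L + L. f k)" by (simp add: add.commute)
    then show ?case using Suc shift[of "q * L" L] by simp
  qed simp
  then show ?thesis using shift by simp
qed

text \<open>Full blocks of length \<open>L\<close> cancel; one incomplete block survives, with fewer
  than \<open>L\<close> terms of norm at most 1.\<close>

lemma norm_sum_le_block:
  fixes f :: "nat \<Rightarrow> 'a::real_normed_vector"
  assumes "0 < L" and zero: "\<And>c. (\<Sum>j<L. f (c * L + j)) = 0" and bound: "\<And>k. norm (f k) \<le> 1"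
  shows "norm (\<Sum>k<Q. f k) \<le> real L"
proof -
  have "(\<Sum>k<Q. f k) = (\<Sum>j<Q mod L. f (Q div L * L + j))"
    using sum_block[of f "Q div L" L "Q mod L"] zero by simp
  also have "norm \<dots> \<le> (\<Sum>j<Q mod L. 1)"
    by (intro sum_norm_le bound)
  also have "\<dots> \<le> real L" using assms(1) by (simp add: less_imp_le)
  finally show ?thesis .
qed

locale vilenkin =
  fixes m :: "nat \<Rightarrow> nat"
  assumes m_ge: "\<And>k. 2 \<le> m k"
begin

abbreviation "M \<equiv> vil_M m"
abbreviation "G \<equiv> vil_group m"
abbreviation "\<mu> \<equiv> vil_measure m"
abbreviation "\<psi> \<equiv> vil_psi m"

section \<open>Digits in the mixed radix system\<close>

lemma m_pos: "0 < m k"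
  using m_ge[of k] by simp

lemma M_pos: "0 < M k"
  using m_pos by (simp add: vil_M_def prod_pos)

lemma M_ge_power: "2 ^ k \<le> M k"
  by (rule vil_M_ge_power) (rule m_ge)

lemma less_M: "k < M k"
  using M_ge_power[of k] less_exp[of k] by linarith

lemma M_dvd: "a \<le> b \<Longrightarrow> M a dvd M b"
  unfolding vil_M_def by (intro prod_dvd_prod_subset) auto

lemma M_mono: "a \<le> b \<Longrightarrow> M a \<le> M b"
  using M_dvd M_pos by (simp add: dvd_imp_le)

lemma vil_digit_eq_0: "n < M a \<Longrightarrow> a \<le> k \<Longrightarrow> vil_digit m n k = 0"
  using M_mono[of a k] by (simp add: vil_digit_def)

lemma finite_vil_digit: "finite {k. vil_digit m n k \<noteq> 0}"
  by (rule vil_digit_expansion(2)) (rule m_ge)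

lemma vil_digit_less: "vil_digit m n k < m k"
  by (rule vil_digit_expansion(1)) (rule m_ge)

text \<open>\<open>q * M a\<close> has digits only at positions from \<open>a\<close> on and
  \<open>r\<close> only below \<open>a\<close>, so the addition produces no carry.\<close>

lemma vil_digit_add:
  assumes "r < M a"
  shows "vil_digit m (q * M a + r) k = vil_digit m (q * M a) k + vil_digit m r k"
proof (cases "k < a")
  case True
  then obtain R where R: "M a = M (Suc k) * R"
    using M_dvd[of "Suc k" a] by auto
  have "(q * M a + r) div M k = m k * (q * R) + r div M k" for r
  proof -
    have "q * M a + r = M k * (m k * (q * R)) + r"
      by (simp add: R vil_M_rec ac_simps)
    then show ?thesis using M_pos[of k] by (simp only: div_mult_self4)
  qed
  from this[of 0] this[of r] show ?thesis
    by (simp add: vil_digit_def)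
next
  case False
  then obtain R where R: "M k = M a * R"
    using M_dvd[of a k] by auto
  have "(q * M a + r) div M k = q * M a div M k"
    using assms M_pos[of a] by (simp add: R div_mult2_eq)
  then show ?thesis using False vil_digit_eq_0[OF assms, of k] by (simp add: vil_digit_def)
qed

lemma vil_digit_mult_M:
  assumes "d < m t"
  shows "vil_digit m (d * M t) k = (if k = t then d else 0)"
proof -
  have *: "d * M t < M (Suc t)"
    using assms M_pos by (simp add: vil_M_rec)
  consider "k < t" | "k = t" | "t < k" by linarith
  then show ?thesis
  proof cases
    case 1
    then obtain R where R: "M t = M (Suc k) * R"
      using M_dvd[of "Suc k" t] by auto
    have "d * M t div M k = d * (m k * R)"
      using M_pos[of k] by (simp add: R vil_M_rec)
    then show ?thesis using 1 by (simp add: vil_digit_def)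
  next
    case 2
    then show ?thesis using assms M_pos[of t] by (simp add: vil_digit_def)
  next
    case 3
    then show ?thesis using vil_digit_eq_0[OF *, of k] by simp
  qed
qed

lemma vil_digit_eqI:
  assumes "\<And>k. vil_digit m i k = vil_digit m j k"
  shows "i = j"
proof -
  have "i = (\<Sum>k | vil_digit m i k \<noteq> 0. vil_digit m i k * M k)"
    by (rule vil_digit_expansion(3)[OF m_ge])
  also have "\<dots> = (\<Sum>k | vil_digit m j k \<noteq> 0. vil_digit m j k * M k)"
    by (simp only: assms)
  also have "\<dots> = j"
    by (rule vil_digit_expansion(3)[OF m_ge, symmetric])
  finally show ?thesis .
qed

text \<open>The character \<open>\<psi> n\<close> with free phases \<open>w k\<close> in place of
  \<open>vil_r m k x\<close>. The phases \<open>vil_r m k x * cnj (vil_r m k y)\<close> give its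
  value at \<open>x - y\<close> without a subtraction on the group.\<close>

definition vil_char :: "(nat \<Rightarrow> complex) \<Rightarrow> nat \<Rightarrow> complex" where
  "vil_char w n = (\<Prod>k | vil_digit m n k \<noteq> 0. w k ^ vil_digit m n k)"

lemma vil_psi_eq_char: "\<psi> n x = vil_char (\<lambda>k. vil_r m k x) n"
  by (simp add: vil_psi_def vil_char_def)

lemma vil_char_superset:
  assumes "finite K" "{k. vil_digit m n k \<noteq> 0} \<subseteq> K"
  shows "vil_char w n = (\<Prod>k\<in>K. w k ^ vil_digit m n k)"
  unfolding vil_char_def using assms by (intro prod.mono_neutral_left) auto

lemma vil_char_add:
  assumes "r < M a"
  shows "vil_char w (q * M a + r) = vil_char w (q * M a) * vil_char w r"
proof -
  let ?K = "{k. vil_digit m (q * M a) k \<noteq> 0} \<union> {k. vil_digit m r k \<noteq> 0}"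
  have "finite ?K" using finite_vil_digit by simp
  then have "vil_char w i = (\<Prod>k\<in>?K. w k ^ vil_digit m i k)" if "i \<in> {q * M a, r, q * M a + r}" for i
    using that by (intro vil_char_superset) (auto simp: vil_digit_add[OF assms])
  then show ?thesis
    by (simp add: vil_digit_add[OF assms] power_add prod.distrib)
qed

lemma vil_char_mult_M: "d < m t \<Longrightarrow> vil_char w (d * M t) = w t ^ d"
  by (subst vil_char_superset[of "{t}"]) (auto simp: vil_digit_mult_M)

lemma norm_vil_char:
  assumes "\<And>k. norm (w k) = 1"
  shows "norm (vil_char w n) = 1"
  by (simp add: vil_char_def prod_norm[symmetric] norm_power assms)

lemma vil_char_cnj: "vil_char w n * cnj (vil_char v n) = vil_char (\<lambda>k. w k * cnj (v k)) n"
  by (simp add: vil_char_def prod.distrib[symmetric] power_mult_distrib)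

lemma sum_root_of_unity:
  fixes z :: complex
  assumes "z ^ n = 1" "z \<noteq> 1"
  shows "(\<Sum>d<n. z ^ d) = 0"
  using assms geometric_sum[of z n] by simp

text \<open>
  Writing \<open>q = d R + q'\<close> with \<open>R = M\<^sub>t / M\<^sub>a\<close> pulls out the geometric sum over the \<open>t\<close>-th digit \<open>d\<close>.
\<close>

lemma sum_vil_char_eq_0:
  assumes "a \<le> t" "w t ^ m t = 1" "w t \<noteq> 1"
  shows "(\<Sum>q<M (Suc t) div M a. vil_char w ((c * (M (Suc t) div M a) + q) * M a)) = 0"
proof -
  obtain R where R: "M t = M a * R"
    using M_dvd[OF assms(1)] by auto
  have R': "M (Suc t) div M a = m t * R"
    using M_pos[of a] by (simp add: R vil_M_rec)
  have inner: "vil_char w ((c * (m t * R) + (d * R + q)) * M a) =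
      vil_char w (c * M (Suc t)) * w t ^ d * vil_char w (q * M a)" if "d < m t" "q < R" for d q
  proof -
    have "q * M a < M t" using that M_pos[of a] by (simp add: R)
    moreover have "d * M t + q * M a < M (Suc t)"
    proof -
      have "d * M t + q * M a < (d + 1) * M t" using \<open>q * M a < M t\<close> by simp
      also have "\<dots> \<le> m t * M t" using that by (intro mult_right_mono) auto
      finally show ?thesis by (simp add: vil_M_rec)
    qed
    moreover have "(c * (m t * R) + (d * R + q)) * M a = c * M (Suc t) + (d * M t + q * M a)"
      by (simp add: R vil_M_rec algebra_simps)
    ultimately show ?thesis
      using vil_char_add[of "d * M t + q * M a" "Suc t" w c] vil_char_add[of "q * M a" t w d]
        vil_char_mult_M[OF that(1)] by (simp add: mult.assoc)
  qed
  have "(\<Sum>q<m t * R. vil_char w ((c * (m t * R) + q) * M a)) =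
      (\<Sum>d<m t. \<Sum>q<R. vil_char w ((c * (m t * R) + (d * R + q)) * M a))"
    using sum_block[of "\<lambda>q. vil_char w ((c * (m t * R) + q) * M a)" "m t" R 0] by simp
  also have "\<dots> = (\<Sum>d<m t. \<Sum>q<R. vil_char w (c * M (Suc t)) * w t ^ d * vil_char w (q * M a))"
    by (intro sum.cong refl inner) auto
  also have "\<dots> = vil_char w (c * M (Suc t)) * (\<Sum>d<m t. w t ^ d) * (\<Sum>q<R. vil_char w (q * M a))"
    by (simp only: sum_distrib_left[symmetric] sum_distrib_right[symmetric])
  finally show ?thesis
    using sum_root_of_unity[OF assms(2,3)] by (simp add: R')
qed

text \<open>\<open>M a\<close> is a multiple of \<open>M (Suc s)\<close>, and each block of that
  length cancels through the digit \<open>s\<close>. Hence the Dirichlet kernels of index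
  \<open>M a\<close> vanish away from a cylinder of the origin.\<close>

lemma sum_vil_char_M_eq_0:
  assumes "s < a" "w s ^ m s = 1" "w s \<noteq> 1"
  shows "(\<Sum>k<M a. vil_char w k) = 0"
proof -
  have "M (Suc s) dvd M a" using assms(1) by (intro M_dvd) simp
  then obtain R where R: "M a = R * M (Suc s)"
    by (metis dvdE mult.commute)
  have "(\<Sum>j<M (Suc s). vil_char w (c * M (Suc s) + j)) = 0" for c
    using sum_vil_char_eq_0[of 0 s w c] assms(2,3) by (simp add: vil_M_rec)
  then show ?thesis
    using sum_block[of "vil_char w" R "M (Suc s)" 0] by (simp add: R)
qed

lemma norm_sum_char_le:
  assumes w1: "\<And>k. norm (w k) = 1"
  shows "norm (\<Sum>i<k. vil_char w i) \<le> real k"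
proof -
  have "norm (\<Sum>i<k. vil_char w i) \<le> (\<Sum>i<k. 1)"
    by (intro sum_norm_le) (simp add: norm_vil_char[OF w1])
  then show ?thesis by simp
qed

lemma norm_sum_sum_char_le:
  assumes w1: "\<And>k. norm (w k) = 1"
  shows "norm (\<Sum>k<n. \<Sum>i<k. vil_char w i) \<le> real n ^ 2"
proof -
  have "norm (\<Sum>k<n. \<Sum>i<k. vil_char w i) \<le> (\<Sum>k<n. real n)"
    by (intro sum_norm_le order_trans[OF norm_sum_char_le[OF w1]]) auto
  then show ?thesis by (simp add: power2_eq_square)
qed

text \<open>Cut the outer sum into blocks of length \<open>L = M (Suc s)\<close>. The digit
  \<open>s\<close> makes the inner sum vanish over each block, so it factors on blocks; the digit
  \<open>t\<close> then bounds the sum over the block positions by \<open>M (Suc t) / L\<close>. The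
  total is at most \<open>(M (Suc t) / L) * L^2 + L^2\<close>, the last term coming from the
  incomplete block.\<close>

lemma norm_sum_sum_char_le_M:
  assumes w1: "\<And>k. norm (w k) = 1" and wm: "\<And>k. w k ^ m k = 1"
    and st: "s < t" "w s \<noteq> 1" "w t \<noteq> 1"
  shows "norm (\<Sum>k<n. \<Sum>i<k. vil_char w i) \<le> 2 * real (M (Suc s)) * real (M (Suc t))"
proof -
  define L where "L = M (Suc s)"
  define h where "h k = (\<Sum>i<k. vil_char w i)" for k
  have L: "0 < L" by (simp add: L_def M_pos)
  have hL: "(\<Sum>j<L. vil_char w (c * L + j)) = 0" for c
    using sum_vil_char_eq_0[of 0 s w c] wm st by (simp add: L_def vil_M_rec)
  have h: "h (q * L + r) = vil_char w (q * L) * h r" if "r < L" for q r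
  proof -
    have "h (q * L + r) = (\<Sum>j<r. vil_char w (q * L + j))"
      unfolding h_def by (subst sum_block) (simp add: hL)
    also have "\<dots> = (\<Sum>j<r. vil_char w (q * L) * vil_char w j)"
      unfolding L_def using that by (intro sum.cong refl vil_char_add) (auto simp: L_def)
    finally show ?thesis by (simp add: h_def sum_distrib_left)
  qed
  define q r where "q = n div L" and "r = n mod L"
  have r: "r < L" using L by (simp add: r_def)
  have "(\<Sum>k<n. h k) = (\<Sum>k<q * L + r. h k)" by (simp add: q_def r_def)
  also have "\<dots> = (\<Sum>c<q. \<Sum>j<L. vil_char w (c * L) * h j) + (\<Sum>j<r. vil_char w (q * L) * h j)"
    unfolding sum_block using r by (intro arg_cong2[where f = "(+)"] sum.cong refl h) auto
  also have "\<dots> = (\<Sum>c<q. vil_char w (c * L)) * (\<Sum>j<L. h j) + vil_char w (q * L) * (\<Sum>j<r. h j)"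
    by (simp only: sum_distrib_left[symmetric] sum_distrib_right[symmetric])
  finally have "norm (\<Sum>k<n. h k) \<le> norm (\<Sum>c<q. vil_char w (c * L)) * norm (\<Sum>j<L. h j)
      + norm (vil_char w (q * L)) * norm (\<Sum>j<r. h j)"
    by (metis norm_mult norm_triangle_ineq)
  \<comment> \<open>Over aligned runs of \<open>M (Suc t) div L\<close> multiples of
    \<open>L\<close> the character sums to 0 because of the digit \<open>t\<close>.\<close>
  moreover have "norm (\<Sum>c<q. vil_char w (c * L)) \<le> real (M (Suc t) div L)"
  proof (rule norm_sum_le_block)
    show "0 < M (Suc t) div L"
      using M_mono[of "Suc s" "Suc t"] st L by (simp add: L_def div_greater_zero_iff)
    show "(\<Sum>j<M (Suc t) div L. vil_char w ((c * (M (Suc t) div L) + j) * L)) = 0" for c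
      unfolding L_def using st wm by (intro sum_vil_char_eq_0) auto
  qed (simp add: norm_vil_char[OF w1])
  moreover have "norm (\<Sum>j<L. h j) \<le> real L ^ 2"
    unfolding h_def by (rule norm_sum_sum_char_le[OF w1])
  moreover have "norm (\<Sum>j<r. h j) \<le> real L ^ 2"
    unfolding h_def using r by (intro order_trans[OF norm_sum_sum_char_le[OF w1]] power_mono) auto
  ultimately have "norm (\<Sum>k<n. h k) \<le> real (M (Suc t) div L) * real L ^ 2 + 1 * real L ^ 2"
    unfolding norm_vil_char[OF w1]
    by (elim order_trans) (intro add_mono mult_mono, auto)
  moreover have "real (M (Suc t) div L) * real L = real (M (Suc t))"
    using M_dvd[of "Suc s" "Suc t"] st unfolding L_def
    by (metis Suc_le_mono dvd_div_mult_self less_imp_le of_nat_mult)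
  moreover have "real L ^ 2 \<le> real L * real (M (Suc t))"
    using M_mono[of "Suc s" "Suc t"] st by (auto simp: L_def power2_eq_square intro!: mult_left_mono)
  ultimately show ?thesis
    by (simp add: h_def L_def[symmetric] power2_eq_square mult.assoc[symmetric]) argo
qed

section \<open>Orthogonality and martingale coefficients\<close>

lemma vil_r_neq_0 [simp]: "vil_r m k x \<noteq> 0"
  by (simp add: vil_r_def)

lemma norm_vil_r [simp]: "norm (vil_r m k x) = 1"
  by (simp add: vil_r_def)

lemma vil_r_power [simp]: "vil_r m k x ^ m k = 1"
  unfolding vil_r_def using m_pos[of k] by (intro complex_root_unity) simp

lemma vil_r_eq_iff:
  assumes "x \<in> G" "y \<in> G"
  shows "vil_r m k x * cnj (vil_r m k y) = 1 \<longleftrightarrow> x k = y k"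
proof -
  have "vil_r m k x * cnj (vil_r m k y) = 1 \<longleftrightarrow> vil_r m k x = vil_r m k y"
    by (metis complex_norm_square mult_right_cancel norm_vil_r of_real_1 one_power2
        complex_cnj_zero_iff vil_r_neq_0)
  also have "\<dots> \<longleftrightarrow> x k mod m k = y k mod m k"
    unfolding vil_r_def using m_pos[of k] by (intro complex_root_unity_eq) simp
  also have "\<dots> \<longleftrightarrow> x k = y k"
    using assms by (auto simp: vil_group_def PiE_iff)
  finally show ?thesis .
qed

lemma norm_vil_psi [simp]: "norm (\<psi> n x) = 1"
  by (simp add: vil_psi_eq_char norm_vil_char)

lemma vil_r_add: "vil_r m k (vil_add m x y) = vil_r m k x * vil_r m k y"
proof -
  have "vil_r m k (vil_add m x y) = exp (2 * of_real pi * \<i> * of_nat (x k + y k) / of_nat (m k))"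
    unfolding vil_r_def vil_add_def using m_pos[of k] by (subst complex_root_unity_eq) auto
  also have "\<dots> = vil_r m k x * vil_r m k y"
    unfolding vil_r_def by (simp add: exp_add[symmetric] add_divide_distrib ring_distribs)
  finally show ?thesis .
qed

lemma vil_psi_add: "\<psi> n (vil_add m x y) = \<psi> n x * \<psi> n y"
  by (simp add: vil_psi_def vil_r_add power_mult_distrib prod.distrib)

lemma vil_psi_cong:
  assumes "i < M A" "\<And>k. k < A \<Longrightarrow> x k = y k"
  shows "\<psi> i x = \<psi> i y"
  unfolding vil_psi_def
  by (rule prod.cong[OF refl]) (metis (mono_tags, lifting) assms vil_digit_eq_0 linorder_not_le
      mem_Collect_eq vil_r_def)

section \<open>Haar measure of digit sets and orthogonality of the system\<close>

lemma prob_space_vil: "prob_space \<mu>"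
  unfolding vil_measure_def by (intro prob_space_PiM prob_space_uniform_digit m_pos)

sublocale prob_space \<mu>
  by (rule prob_space_vil)

lemma measurable_digit [measurable]: "(\<lambda>x. x k) \<in> measurable \<mu> (count_space UNIV)"
proof -
  have 1: "(\<lambda>x. x k) \<in> measurable \<mu> (uniform_count_measure {..<m k})"
    unfolding vil_measure_def by (rule measurable_component_singleton) simp
  have 2: "(\<lambda>n. n) \<in> measurable (uniform_count_measure {..<m k}) (count_space UNIV)"
    by (simp add: measurable_def sets_uniform_count_measure space_uniform_count_measure)
  show ?thesis
    using measurable_comp[OF 1 2] by (simp add: comp_def)
qed

lemma measurable_vil_r [measurable]: "vil_r m k \<in> borel_measurable \<mu>"
proof -
  have "(\<lambda>a::nat. exp (2 * of_real pi * \<i> * of_nat a / of_nat (m k)) :: complex)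
      \<in> borel_measurable (count_space UNIV)"
    by simp
  from measurable_compose[OF measurable_digit[of k] this] show ?thesis
    by (simp add: vil_r_def[abs_def])
qed

lemma measurable_vil_psi [measurable]: "\<psi> n \<in> borel_measurable \<mu>"
  unfolding vil_psi_def[abs_def] by measurable

lemma measurable_cnj_vil_psi [measurable]: "(\<lambda>x. cnj (\<psi> n x)) \<in> borel_measurable \<mu>"
  by (rule measurable_compose[OF measurable_vil_psi])
    (intro borel_measurable_continuous_onI continuous_intros)

lemma measurable_vil_add:
  assumes "y \<in> G"
  shows "(\<lambda>x. vil_add m x y) \<in> measurable \<mu> \<mu>"
  unfolding vil_measure_def
proof (rule measurable_PiM_single')
  fix k :: nat
  let ?U = "\<lambda>k. uniform_count_measure {..<m k}"
  have "(\<lambda>a. (a + y k) mod m k) \<in> measurable (?U k) (?U k)"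
    using m_pos[of k]
    by (auto simp: measurable_def sets_uniform_count_measure space_uniform_count_measure)
  from measurable_comp[OF measurable_component_singleton[of k UNIV ?U] this]
  show "(\<lambda>x. vil_add m x y k) \<in> measurable (Pi\<^sub>M UNIV ?U) (?U k)"
    by (simp add: vil_add_def comp_def)
qed (use m_pos in \<open>auto simp: space_PiM space_uniform_count_measure vil_add_def\<close>)

text \<open>By independence of the digits. The set \<open>J\<close> is arbitrary because the sets
  met later leave one digit \<open>s\<close> below \<open>t\<close> free.\<close>

lemma emeasure_vil_agree:
  assumes "finite J" "y \<in> G"
  shows "emeasure \<mu> {x \<in> G. \<forall>j\<in>J. x j = y j} = ennreal (\<Prod>j\<in>J. 1 / real (m j))"
proof -
  let ?U = "\<lambda>k. uniform_count_measure {..<m k}"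
  interpret P: product_prob_space ?U UNIV
    by (intro product_prob_spaceI prob_space_uniform_digit m_pos)
  have y: "y j < m j" for j using assms(2) by (auto simp: vil_group_def)
  have "emeasure \<mu> {x \<in> G. \<forall>j\<in>J. x j \<in> {y j}} = (\<Prod>j\<in>J. emeasure (?U j) {y j})"
    unfolding space_vil_measure[symmetric] vil_measure_def
    using assms(1) y by (intro P.emeasure_PiM_Collect) (auto simp: sets_uniform_count_measure)
  also have "\<dots> = (\<Prod>j\<in>J. ennreal (1 / real (m j)))"
    using y by (intro prod.cong refl) (simp add: emeasure_uniform_count_measure)
  finally show ?thesis by (simp add: prod_ennreal)
qed

text \<open>Let \<open>k\<close> be a position where the digits of \<open>i\<close> and
  \<open>j\<close> differ. Translation by the element with the single nonzero digit 1 at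
  \<open>k\<close> multiplies the integrand by a constant \<open>c \<noteq> 1\<close> but preserves
  the integral, which is therefore 0.\<close>

lemma vil_psi_orthogonal:
  assumes "i \<noteq> j"
  shows "(\<integral>x. \<psi> i x * cnj (\<psi> j x) \<partial>\<mu>) = 0"
proof -
  obtain k where k: "vil_digit m i k \<noteq> vil_digit m j k"
    using assms vil_digit_eqI by blast
  define y where "y = (\<lambda>l. if l = k then 1 else 0 :: nat)"
  define c where "c = \<psi> i y * cnj (\<psi> j y)"
  have y: "y \<in> G"
    using m_ge m_pos by (auto simp: vil_group_def y_def intro: Suc_le_lessD[OF order_trans[OF _ m_ge]])
  have psi_y: "\<psi> n y = exp (2 * of_real pi * \<i> * of_nat (vil_digit m n k) / of_nat (m k))" for n
  proof -
    let ?r = "exp (2 * of_real pi * \<i> / of_nat (m k))"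
    have "\<psi> n y = (\<Prod>l\<in>insert k {l. vil_digit m n l \<noteq> 0}. vil_r m l y ^ vil_digit m n l)"
      unfolding vil_psi_eq_char using finite_vil_digit by (intro vil_char_superset) auto
    also have "\<dots> = (\<Prod>l\<in>insert k {l. vil_digit m n l \<noteq> 0}. if l = k then ?r ^ vil_digit m n l else 1)"
      by (intro prod.cong refl) (auto simp: vil_r_def y_def)
    also have "\<dots> = ?r ^ vil_digit m n k"
      using finite_vil_digit by (subst prod.delta) auto
    also have "\<dots> = exp (2 * of_real pi * \<i> * of_nat (vil_digit m n k) / of_nat (m k))"
      by (simp add: exp_of_nat_mult[symmetric] mult.commute)
    finally show ?thesis .
  qed
  have c: "c \<noteq> 1"
  proof
    assume "c = 1"
    then have "\<psi> i y = \<psi> j y"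
      unfolding c_def by (metis complex_norm_square mult_right_cancel norm_vil_psi of_real_1 one_power2
        complex_cnj_zero_iff norm_zero zero_neq_one)
    then have "vil_digit m i k mod m k = vil_digit m j k mod m k"
      unfolding psi_y using m_pos[of k] by (subst (asm) complex_root_unity_eq) auto
    then show False using k vil_digit_less by simp
  qed
  let ?h = "\<lambda>x. \<psi> i x * cnj (\<psi> j x)"
  have "integral\<^sup>L \<mu> ?h = integral\<^sup>L (distr \<mu> \<mu> (\<lambda>x. vil_add m x y)) ?h"
    using vil_measure_invariant[OF m_ge y] by simp
  also have "\<dots> = (\<integral>x. ?h (vil_add m x y) \<partial>\<mu>)"
    by (rule integral_distr[OF measurable_vil_add[OF y]]) measurable
  also have "\<dots> = (\<integral>x. c * ?h x \<partial>\<mu>)"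
    by (simp add: vil_psi_add c_def ac_simps)
  also have "\<dots> = c * integral\<^sup>L \<mu> ?h" by simp
  finally show ?thesis using c by simp
qed

lemma vil_psi_norm_square: "\<psi> i x * cnj (\<psi> i x) = 1"
  by (metis complex_norm_square norm_vil_psi of_real_1 one_power2)

lemma vil_coeff_cong:
  assumes "\<And>x. x \<in> G \<Longrightarrow> f x = g x"
  shows "vil_coeff m f i = vil_coeff m g i"
  unfolding vil_coeff_def by (rule Bochner_Integration.integral_cong) (auto simp: space_vil_measure assms)

lemma integrable_psi_cnj: "integrable \<mu> (\<lambda>x. \<psi> i x * cnj (\<psi> j x))"
  by (rule integrable_const_bound[where B = 1]) (auto simp: norm_mult)

lemma vil_coeff_sum:
  "vil_coeff m (\<lambda>x. \<Sum>j<N. c j * \<psi> j x) i = (if i < N then c i else 0)"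
proof -
  have "vil_coeff m (\<lambda>x. \<Sum>j<N. c j * \<psi> j x) i = (\<integral>x. (\<Sum>j<N. c j * (\<psi> j x * cnj (\<psi> i x))) \<partial>\<mu>)"
    by (simp add: vil_coeff_def sum_distrib_right mult.assoc)
  also have "\<dots> = (\<Sum>j<N. c j * (\<integral>x. \<psi> j x * cnj (\<psi> i x) \<partial>\<mu>))"
    by (simp add: integrable_psi_cnj)
  also have "\<dots> = (\<Sum>j<N. if j = i then c j else 0)"
  proof (intro sum.cong refl)
    fix j
    show "c j * (\<integral>x. \<psi> j x * cnj (\<psi> i x) \<partial>\<mu>) = (if j = i then c j else 0)"
      using prob_space by (cases "j = i") (auto simp: vil_psi_orthogonal vil_psi_norm_square)
  qed
  finally show ?thesis by (simp add: sum.delta)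
qed

lemma mart_coeffI:
  assumes "\<And>n. A \<le> n \<Longrightarrow> vil_coeff m (f n) i = c"
  shows "mart_coeff m f i = c"
  unfolding mart_coeff_def
  by (rule limI, rule tendsto_eventually) (use assms in \<open>auto simp: eventually_sequentially\<close>)

text \<open>The martingale identity makes \<open>f A\<close> a partial sum of every later
  \<open>f n\<close>, so by orthogonality the coefficients below \<open>M A\<close> are constant
  from level \<open>A\<close> on.\<close>

lemma mart_coeff_eq:
  assumes f: "vil_martingale m f" and i: "i < M A"
  shows "mart_coeff m f i = vil_coeff m (f A) i"
proof (rule mart_coeffI)
  fix n assume "A \<le> n"
  have "vil_coeff m (f A) i = vil_coeff m (vil_S m (M A) (f n)) i"
    using f \<open>A \<le> n\<close> by (intro vil_coeff_cong) (simp add: vil_martingale_def)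
  then show "vil_coeff m (f n) i = vil_coeff m (f A) i"
    using i by (simp add: vil_S_def[abs_def] vil_coeff_sum)
qed

section \<open>The Fejer kernel\<close>

text \<open>Unnormalised: \<open>n\<close> times the usual Fejer kernel at
  \<open>x - y\<close>.\<close>

definition fejer_kernel :: "nat \<Rightarrow> (nat \<Rightarrow> nat) \<Rightarrow> (nat \<Rightarrow> nat) \<Rightarrow> complex" where
  "fejer_kernel n x y = (\<Sum>k=1..n. \<Sum>i<k. \<psi> i x * cnj (\<psi> i y))"

lemma measurable_fejer_kernel [measurable]: "fejer_kernel n x \<in> borel_measurable \<mu>"
  unfolding fejer_kernel_def[abs_def] by measurable

lemma fejer_kernel_cong:
  assumes "n \<le> M A" "\<And>k. k < A \<Longrightarrow> y k = z k"
  shows "fejer_kernel n x y = fejer_kernel n x z"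
proof -
  have "\<psi> i y = \<psi> i z" if "i < n" for i
    using that assms by (intro vil_psi_cong[of i A]) auto
  then show ?thesis
    unfolding fejer_kernel_def by (intro sum.cong refl) auto
qed

text \<open>
  If \<open>x\<close> and \<open>y\<close> differ in at most one digit, \<open>t\<close> is merely chosen so large that the trivial
  bound \<open>n\<^sup>2\<close> suffices.
\<close>

lemma norm_fejer_kernel_le:
  assumes x: "x \<in> G" and y: "y \<in> G"
  obtains s t where "s < t" "\<forall>i\<in>{..<t} - {s}. x i = y i"
    "norm (fejer_kernel n x y) \<le> 2 * real (M (Suc s)) * real (M (Suc t))"
proof -
  define w where "w k = vil_r m k x * cnj (vil_r m k y)" for k
  have w1: "norm (w k) = 1" for k by (simp add: w_def norm_mult)
  have wm: "w k ^ m k = 1" for k by (simp add: w_def power_mult_distrib flip: complex_cnj_power)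
  have w_iff: "w k = 1 \<longleftrightarrow> x k = y k" for k
    using vil_r_eq_iff[OF x y] by (simp add: w_def)
  have kernel: "fejer_kernel n x y = (\<Sum>k<Suc n. \<Sum>i<k. vil_char w i)"
  proof -
    \<comment> \<open>The summand at \<open>k = 0\<close> is an empty sum; including it gives the
      range \<open>k < Suc n\<close> of the kernel estimates.\<close>
    have "(\<Sum>k<Suc n. \<Sum>i<k. vil_char w i) = (\<Sum>k=1..n. \<Sum>i<k. vil_char w i)"
      by (rule sum.mono_neutral_right) (auto simp: not_less_eq_eq)
    then show ?thesis
      by (simp add: fejer_kernel_def vil_psi_eq_char vil_char_cnj w_def[abs_def])
  qed
  show thesis
  proof (cases "\<exists>s t. s < t \<and> x s \<noteq> y s \<and> x t \<noteq> y t")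
    case True
    then obtain s0 t0 where st0: "s0 < t0" "x s0 \<noteq> y s0" "x t0 \<noteq> y t0" by blast
    define s where "s = (LEAST s. x s \<noteq> y s)"
    have s: "x s \<noteq> y s"
      unfolding s_def using st0(2) by (rule LeastI)
    have s': "x i = y i" if "i < s" for i
      using not_less_Least[of i "\<lambda>s. x s \<noteq> y s"] that by (simp add: s_def)
    have "s \<le> s0" unfolding s_def using st0 by (intro Least_le)
    define t where "t = (LEAST t. s < t \<and> x t \<noteq> y t)"
    have t: "s < t \<and> x t \<noteq> y t"
      unfolding t_def by (rule LeastI[of _ t0]) (use st0 \<open>s \<le> s0\<close> in auto)
    have t': "x i = y i" if "i < t" "s < i" for i
      using not_less_Least[of i "\<lambda>t. s < t \<and> x t \<noteq> y t"] that by (simp add: t_def)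
    show thesis
    proof (rule that)
      show "s < t" using t by simp
      show "\<forall>i\<in>{..<t} - {s}. x i = y i"
      proof
        fix i assume "i \<in> {..<t} - {s}"
        then show "x i = y i" using s'[of i] t'[of i] by (cases "i < s") auto
      qed
      show "norm (fejer_kernel n x y) \<le> 2 * real (M (Suc s)) * real (M (Suc t))"
        unfolding kernel using s t by (intro norm_sum_sum_char_le_M w1 wm) (auto simp: w_iff)
    qed
  next
    case False
    have "\<exists>s. \<forall>i. i \<noteq> s \<longrightarrow> x i = y i"
    proof (cases "\<exists>s. x s \<noteq> y s")
      case True
      then obtain s where "x s \<noteq> y s" ..
      then have "x i = y i" if "i \<noteq> s" for i
        using False that \<open>x s \<noteq> y s\<close> linorder_neqE_nat[of i s] by blast
      then show ?thesis by blast
    qed simp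
    then obtain s where s: "\<And>i. i \<noteq> s \<Longrightarrow> x i = y i" by blast
    define t where "t = s + Suc n ^ 2 + 1"
    show thesis
    proof (rule that)
      show "s < t" by (simp add: t_def)
      show "\<forall>i\<in>{..<t} - {s}. x i = y i" using s by auto
      have "norm (fejer_kernel n x y) \<le> real (Suc n) ^ 2"
        unfolding kernel by (rule norm_sum_sum_char_le[OF w1])
      also have "\<dots> = real (Suc n ^ 2)" by simp
      also have "\<dots> \<le> real (M (Suc t))"
        using less_M[of "Suc t"] unfolding of_nat_le_iff t_def by linarith
      also have "\<dots> \<le> 2 * real (M (Suc s)) * real (M (Suc t))"
        using M_pos[of "Suc s"] by (simp add: mult_le_cancel_right1)
      finally show "norm (fejer_kernel n x y) \<le> 2 * real (M (Suc s)) * real (M (Suc t))" .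
    qed
  qed
qed

lemma integrable_mult_psi:
  assumes "integrable \<mu> f"
  shows "integrable \<mu> (\<lambda>y. f y * (c * cnj (\<psi> i y)))"
proof (rule Bochner_Integration.integrable_bound)
  show "integrable \<mu> (\<lambda>y. c * f y)" using assms by simp
  have [measurable]: "f \<in> borel_measurable \<mu>" using assms by simp
  show "(\<lambda>y. f y * (c * cnj (\<psi> i y))) \<in> borel_measurable \<mu>" by measurable
qed (simp add: norm_mult mult.commute)

text \<open>Only coefficients below \<open>n \<le> M A\<close> occur, so the single integrable
  function \<open>f A\<close> determines the mean, and finite sums pass under the integral.\<close>

lemma mart_sigma_eq_integral:
  assumes f: "vil_martingale m f" and n: "0 < n" "n \<le> M A"
  shows "of_nat n * mart_sigma m n f x = (\<integral>y. f A y * fejer_kernel n x y \<partial>\<mu>)"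
proof -
  have int: "integrable \<mu> (f A)" using f by (simp add: vil_martingale_def)
  have "of_nat n * mart_sigma m n f x = (\<Sum>k=1..n. \<Sum>i<k. mart_coeff m f i * \<psi> i x)"
    using n by (simp add: mart_sigma_def mart_S_def)
  also have "\<dots> = (\<Sum>k=1..n. \<Sum>i<k. \<integral>y. f A y * (\<psi> i x * cnj (\<psi> i y)) \<partial>\<mu>)"
  proof (intro sum.cong refl)
    fix k i assume "k \<in> {1..n}" "i \<in> {..<k}"
    then have "mart_coeff m f i * \<psi> i x = (\<integral>y. f A y * cnj (\<psi> i y) \<partial>\<mu>) * \<psi> i x"
      using n mart_coeff_eq[OF f, of i A] by (simp add: vil_coeff_def)
    also have "\<dots> = (\<integral>y. f A y * cnj (\<psi> i y) * \<psi> i x \<partial>\<mu>)" by simp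
    finally show "mart_coeff m f i * \<psi> i x = (\<integral>y. f A y * (\<psi> i x * cnj (\<psi> i y)) \<partial>\<mu>)"
      by (simp add: ac_simps)
  qed
  also have "\<dots> = (\<integral>y. f A y * fejer_kernel n x y \<partial>\<mu>)"
    by (simp add: fejer_kernel_def sum_distrib_left integrable_mult_psi[OF int])
  finally show ?thesis .
qed

text \<open>
  For exponents below 1 the \<open>L\<^sub>1\<close> norm is controlled by the \<open>L\<^sub>p\<close> quasi-norm at a fixed scale,
  since a function constant on cylinders of measure \<open>1 / M\<^sub>A\<close> is bounded by
  \<open>(M\<^sub>A \<integral>g\<^sup>p)\<^bsup>1/p\<^esup>\<close>.
\<close>

lemma nn_integral_powr_le:
  fixes g :: "(nat \<Rightarrow> nat) \<Rightarrow> real"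
  assumes p: "0 < p" "p \<le> 1" and g0: "\<And>y. 0 \<le> g y" and [measurable]: "g \<in> borel_measurable \<mu>"
    and level: "\<And>y z. y \<in> G \<Longrightarrow> z \<in> G \<Longrightarrow> (\<And>k. k < A \<Longrightarrow> y k = z k) \<Longrightarrow> g y = g z"
    and I: "0 \<le> I" "ennreal I \<le> (\<integral>\<^sup>+y. ennreal (g y) \<partial>\<mu>)"
  shows "ennreal (I powr p) \<le> ennreal (real (M A) powr (1 - p)) * (\<integral>\<^sup>+y. ennreal (g y powr p) \<partial>\<mu>)"
proof (cases "\<integral>\<^sup>+y. ennreal (g y powr p) \<partial>\<mu>")
  case (real l)
  have MA: "0 < real (M A)" using M_pos by simp
  define K where "K = (real (M A) * l) powr (1 / p)"
  have bound: "g y \<le> K" if y: "y \<in> G" for y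
  proof -
    let ?C = "{z \<in> G. \<forall>j\<in>{..<A}. z j = y j}"
    have C: "emeasure \<mu> ?C = ennreal (1 / real (M A))"
      using emeasure_vil_agree[OF _ y, of "{..<A}"] by (simp add: vil_M_def prod_dividef)
    have [measurable]: "?C \<in> sets \<mu>"
      unfolding space_vil_measure[symmetric] by measurable
    have "ennreal (g y powr p / real (M A)) = ennreal (g y powr p) * emeasure \<mu> ?C"
      unfolding C by (simp add: ennreal_mult[symmetric])
    also have "\<dots> = (\<integral>\<^sup>+z. ennreal (g y powr p) * indicator ?C z \<partial>\<mu>)"
      by (simp add: nn_integral_cmult_indicator)
    also have "\<dots> \<le> (\<integral>\<^sup>+z. ennreal (g z powr p) \<partial>\<mu>)"
      using level[OF y] by (intro nn_integral_mono) (auto simp: indicator_def)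
    finally have "g y powr p / real (M A) \<le> l" using real by simp
    then have "g y powr p \<le> real (M A) * l" using MA by (simp add: field_simps)
    then have "(g y powr p) powr (1 / p) \<le> K"
      unfolding K_def using p by (intro powr_mono2) auto
    then show ?thesis using p g0 by (simp add: powr_powr)
  qed
  \<comment> \<open>Split \<open>g\<close> as \<open>g powr (1 - p) * g powr p\<close> and bound the
    first factor through \<open>K\<close>. On raising to the power \<open>p\<close>, the factor
    \<open>K\<close> contributes \<open>(M A * l) powr (1 - p)\<close>.\<close>
  have "(\<integral>\<^sup>+y. ennreal (g y) \<partial>\<mu>) \<le> (\<integral>\<^sup>+y. ennreal (K powr (1 - p)) * ennreal (g y powr p) \<partial>\<mu>)"
  proof (rule nn_integral_mono)
    fix y assume "y \<in> space \<mu>"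
    then have "g y powr (1 - p) \<le> K powr (1 - p)"
      using bound g0 p by (intro powr_mono2) (auto simp: space_vil_measure)
    then have "g y powr (1 - p) * g y powr p \<le> K powr (1 - p) * g y powr p"
      by (intro mult_right_mono) auto
    then show "ennreal (g y) \<le> ennreal (K powr (1 - p)) * ennreal (g y powr p)"
      using g0 by (simp add: ennreal_mult[symmetric] powr_add[symmetric])
  qed
  also have "\<dots> = ennreal (K powr (1 - p) * l)"
    using real by (simp add: nn_integral_cmult ennreal_mult)
  finally have "ennreal I \<le> ennreal (K powr (1 - p) * l)"
    by (rule order_trans[OF I(2)])
  then have "I \<le> K powr (1 - p) * l"
    using real by simp
  then have "I powr p \<le> (K powr (1 - p) * l) powr p"
    using I p by (intro powr_mono2) auto
  also have "\<dots> = real (M A) powr (1 - p) * l"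
  proof (cases "l = 0")
    case False
    then have "0 < l" using real by simp
    have "(K powr (1 - p) * l) powr p = (real (M A) * l) powr (1 - p) * l powr p"
      using real p by (simp add: K_def powr_mult powr_powr)
    also have "\<dots> = real (M A) powr (1 - p) * (l powr (1 - p) * l powr p)"
      using real by (simp add: powr_mult mult.assoc)
    also have "l powr (1 - p) * l powr p = l"
      using \<open>0 < l\<close> by (simp add: powr_add[symmetric])
    finally show ?thesis .
  qed (use p in simp)
  finally show ?thesis
    using real by (simp add: ennreal_mult[symmetric])
qed (use M_pos[of A] in \<open>simp add: ennreal_mult_top\<close>)

text \<open>A majorant, independent of \<open>n\<close>, of the \<open>p\<close>-th power of the
  kernel. It adds the bounds for all pairs \<open>s < t\<close> compatible with \<open>x\<close> and
  \<open>y\<close> instead of selecting one, so it is jointly measurable and can be integrated term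
  by term.\<close>

definition vil_weight :: "real \<Rightarrow> (nat \<Rightarrow> nat) \<Rightarrow> (nat \<Rightarrow> nat) \<Rightarrow> ennreal" where
  "vil_weight p x y = (\<Sum>t. \<Sum>s<t. if \<forall>i\<in>{..<t} - {s}. x i = y i
     then ennreal ((2 * real (M (Suc s)) * real (M (Suc t))) powr p) else 0)"

lemma fejer_kernel_le_weight:
  assumes x: "x \<in> G" and y: "y \<in> G" and p: "0 \<le> p"
  shows "ennreal (norm (fejer_kernel n x y) powr p) \<le> vil_weight p x y"
proof -
  obtain s t where st: "s < t" "\<forall>i\<in>{..<t} - {s}. x i = y i"
    "norm (fejer_kernel n x y) \<le> 2 * real (M (Suc s)) * real (M (Suc t))"
    using norm_fejer_kernel_le[OF x y] .
  define h where "h t s = (if \<forall>i\<in>{..<t} - {s}. x i = y i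
    then ennreal ((2 * real (M (Suc s)) * real (M (Suc t))) powr p) else 0)" for t s :: nat
  have "ennreal (norm (fejer_kernel n x y) powr p) \<le> h t s"
    unfolding h_def using st p by (auto intro!: ennreal_leI powr_mono2)
  also have "\<dots> \<le> (\<Sum>s<t. h t s)"
    using st(1) by (intro member_le_sum) auto
  also have "\<dots> \<le> (\<Sum>t. \<Sum>s<t. h t s)"
    using sum_le_suminf[of "\<lambda>t. \<Sum>s<t. h t s" "{t}"] by simp
  finally show ?thesis by (simp add: vil_weight_def h_def)
qed

lemma measurable_vil_weight [measurable]:
  "(\<lambda>z. vil_weight p (fst z) (snd z)) \<in> borel_measurable (\<mu> \<Otimes>\<^sub>M \<mu>)"
proof -
  let ?N = "\<mu> \<Otimes>\<^sub>M \<mu>"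
  have eq: "Measurable.pred ?N (\<lambda>z. f z = g z)"
    if "f \<in> measurable ?N (count_space UNIV)" "g \<in> measurable ?N (count_space UNIV)"
    for f g :: "_ \<Rightarrow> nat"
  proof -
    have "{z \<in> space ?N. f z = g z} = (\<Union>a. (f -` {a} \<inter> space ?N) \<inter> (g -` {a} \<inter> space ?N))"
      by auto
    also have "\<dots> \<in> sets ?N"
      using that by (intro sets.countable_UN image_subsetI sets.Int measurable_sets) auto
    finally show ?thesis by (simp add: pred_def)
  qed
  have "Measurable.pred (\<mu> \<Otimes>\<^sub>M \<mu>) (\<lambda>z. fst z i = snd z i)" for i
    by (rule eq[OF measurable_compose[OF measurable_fst measurable_digit]
          measurable_compose[OF measurable_snd measurable_digit]])
  then have "Measurable.pred (\<mu> \<Otimes>\<^sub>M \<mu>) (\<lambda>z. \<forall>i\<in>{..<t} - {s}. fst z i = snd z i)" for s t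
    by (intro pred_intros_finite) auto
  then show ?thesis
    unfolding vil_weight_def
    by (intro borel_measurable_suminf_order borel_measurable_sum measurable_If) auto
qed

text \<open>The \<open>x\<close> that agree with \<open>y\<close> below \<open>t\<close> except
  possibly at \<open>s\<close> have measure \<open>m s / M t\<close>, and the summand there is at
  most of order \<open>M t powr (2 * p)\<close>. The product decays geometrically in
  \<open>t\<close> because \<open>p < 1 / 2\<close>, which beats the \<open>t\<close> choices of
  \<open>s\<close>.\<close>

lemma nn_integral_vil_weight:
  assumes p: "0 < p" "p < 1 / 2" and B: "\<And>k. m k \<le> B"
  obtains C where "0 < C" "\<And>y. y \<in> G \<Longrightarrow> (\<integral>\<^sup>+x. vil_weight p x y \<partial>\<mu>) \<le> ennreal C"
proof -
  define \<rho> where "\<rho> = (2::real) powr (2 * p - 1)"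
  have \<rho>: "0 < \<rho>" "\<rho> < 1" using p by (auto simp: \<rho>_def powr_less_one)
  have B0: "1 \<le> real B" using m_pos[of 0] B[of 0] by simp
  \<comment> \<open>The first factor comes from \<open>M (Suc s) \<le> B * M t\<close> and
    \<open>M (Suc t) \<le> B * M t\<close>, the second from the free digit \<open>s\<close>.\<close>
  define D where "D = (2 * real B ^ 2) powr p * real B"
  have D0: "0 \<le> D" by (simp add: D_def)
  have D_term: "(2 * real (M (Suc s)) * real (M (Suc t))) powr p * (\<Prod>j\<in>{..<t} - {s}. 1 / real (m j))
    \<le> D * \<rho> ^ t" if "s < t" for s t :: nat
  proof -
    have Mt: "1 \<le> real (M t)" "0 < real (M t)" "0 < real (M s)" "real (M s) \<le> real (M t)"
      using M_pos[of t] M_pos[of s] M_mono[of s t] that by auto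
    have "2 * real (M (Suc s)) * real (M (Suc t)) = 2 * (real (m s) * real (m t)) * (real (M s) * real (M t))"
      by (simp add: vil_M_rec)
    also have "\<dots> \<le> 2 * (real B * real B) * (real (M t) * real (M t))"
      using B Mt by (intro mult_mono) auto
    finally have "(2 * real (M (Suc s)) * real (M (Suc t))) powr p \<le>
        ((2 * real B ^ 2) * (real (M t) * real (M t))) powr p"
      using p by (intro powr_mono2) (auto simp: power2_eq_square)
    also have "\<dots> = (2 * real B ^ 2) powr p * (real (M t) powr p * real (M t) powr p)"
      by (simp add: powr_mult)
    also have "real (M t) powr p * real (M t) powr p = real (M t) powr (2 * p)"
      by (simp flip: powr_add)
    finally have 1: "(2 * real (M (Suc s)) * real (M (Suc t))) powr p \<le>
      (2 * real B ^ 2) powr p * real (M t) powr (2 * p)" .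
    have "real (M t) = real (m s) * (\<Prod>j\<in>{..<t} - {s}. real (m j))"
      unfolding vil_M_def using that by (simp add: prod.remove[of "{..<t}" s])
    then have "(\<Prod>j\<in>{..<t} - {s}. 1 / real (m j)) = real (m s) / real (M t)"
      using m_pos Mt by (simp add: prod_dividef field_simps)
    also have "\<dots> \<le> real B / real (M t)"
      using B Mt by (intro divide_right_mono) auto
    finally have 2: "(\<Prod>j\<in>{..<t} - {s}. 1 / real (m j)) \<le> real B / real (M t)" .
    have "(2 * real (M (Suc s)) * real (M (Suc t))) powr p * (\<Prod>j\<in>{..<t} - {s}. 1 / real (m j)) \<le>
        (2 * real B ^ 2) powr p * real (M t) powr (2 * p) * (real B / real (M t))"
      using 1 2 by (intro mult_mono prod_nonneg) auto
    also have "\<dots> = D * real (M t) powr (2 * p - 1)"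
      using Mt by (simp add: D_def powr_diff)
    \<comment> \<open>The exponent is negative, so the lower bound on \<open>M t\<close> gives an
      upper bound.\<close>
    also have "real (M t) powr (2 * p - 1) \<le> (2 ^ t) powr (2 * p - 1)"
    proof (rule powr_mono2')
      show "(2::real) ^ t \<le> real (M t)"
        using M_ge_power[of t] by (metis of_nat_le_iff of_nat_numeral of_nat_power)
    qed (use p in auto)
    also have "(2 ^ t) powr (2 * p - 1) = \<rho> ^ t"
      by (simp add: \<rho>_def powr_powr powr_realpow[symmetric] mult.commute)
    finally show ?thesis using D0 by (simp add: mult_left_mono)
  qed
  have summ: "summable (\<lambda>t. real t * (D * \<rho> ^ t))"
  proof -
    have "summable (\<lambda>t. real (Suc t) * \<rho> ^ t)"
      using geometric_deriv_sums[of \<rho>] \<rho> by (auto simp: sums_iff)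
    then have "summable (\<lambda>t. D * (real (Suc t) * \<rho> ^ t))" by (rule summable_mult)
    then show ?thesis
      by (rule summable_comparison_test_ev[rotated])
        (use D0 \<rho> in \<open>auto simp: mult_left_mono mult_right_mono algebra_simps\<close>)
  qed
  define C where "C = (\<Sum>t. real t * (D * \<rho> ^ t)) + 1"
  have C: "0 < C" unfolding C_def using D0 \<rho> suminf_nonneg[OF summ] by (simp add: add_nonneg_pos)
  show thesis
  proof (rule that[OF C])
    fix y assume y: "y \<in> G"
    have "(\<integral>\<^sup>+x. vil_weight p x y \<partial>\<mu>) = (\<Sum>t. \<Sum>s<t. \<integral>\<^sup>+x. (if \<forall>i\<in>{..<t} - {s}. x i = y i
        then ennreal ((2 * real (M (Suc s)) * real (M (Suc t))) powr p) else 0) \<partial>\<mu>)"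
      unfolding vil_weight_def by (simp add: nn_integral_suminf nn_integral_sum)
    also have "\<dots> \<le> (\<Sum>t. \<Sum>s<t. ennreal (D * \<rho> ^ t))"
    proof (intro suminf_le sum_mono summableI)
      fix t s :: nat assume "s \<in> {..<t}"
      let ?c = "(2 * real (M (Suc s)) * real (M (Suc t))) powr p"
      let ?A = "{x \<in> G. \<forall>i\<in>{..<t} - {s}. x i = y i}"
      have [measurable]: "?A \<in> sets \<mu>"
        unfolding space_vil_measure[symmetric] by measurable
      have "(\<integral>\<^sup>+x. (if \<forall>i\<in>{..<t} - {s}. x i = y i then ennreal ?c else 0) \<partial>\<mu>)
          = (\<integral>\<^sup>+x. ennreal ?c * indicator ?A x \<partial>\<mu>)"
        by (intro nn_integral_cong) (auto simp: indicator_def space_vil_measure)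
      also have "\<dots> = ennreal ?c * ennreal (\<Prod>j\<in>{..<t} - {s}. 1 / real (m j))"
        using emeasure_vil_agree[OF _ y, of "{..<t} - {s}"] by (simp add: nn_integral_cmult_indicator)
      also have "\<dots> \<le> ennreal (D * \<rho> ^ t)"
        using D_term[of s t] \<open>s \<in> {..<t}\<close>
        by (simp add: ennreal_mult[symmetric] prod_nonneg ennreal_leI)
      finally show "(\<integral>\<^sup>+x. (if \<forall>i\<in>{..<t} - {s}. x i = y i then ennreal ?c else 0) \<partial>\<mu>)
        \<le> ennreal (D * \<rho> ^ t)" .
    qed
    also have "\<dots> = (\<Sum>t. ennreal (real t * (D * \<rho> ^ t)))"
      by (simp add: ennreal_mult' ennreal_of_nat_eq_real_of_nat)
    also have "\<dots> = ennreal (\<Sum>t. real t * (D * \<rho> ^ t))"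
      using D0 \<rho> summ by (intro suminf_ennreal2) auto
    also have "\<dots> \<le> ennreal C" by (simp add: C_def ennreal_leI)
    finally show "(\<integral>\<^sup>+x. vil_weight p x y \<partial>\<mu>) \<le> ennreal C" .
  qed
qed

text \<open>Take the least \<open>A\<close>; its predecessor has \<open>M a < n\<close>, and one
  more digit costs at most the factor \<open>B\<close>.\<close>

lemma exists_M_between:
  assumes B: "\<And>k. m k \<le> B" and n: "0 < n"
  obtains A where "n \<le> M A" "M A \<le> B * n"
proof -
  define A where "A = (LEAST A. n \<le> M A)"
  have A: "n \<le> M A"
    unfolding A_def by (rule LeastI[of _ n]) (use less_M[of n] in simp)
  show thesis
  proof (rule that[OF A])
    show "M A \<le> B * n"
    proof (cases A)
      case 0
      then show ?thesis using n m_pos[of 0] B[of 0] by (simp add: vil_M_rec)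
    next
      case (Suc a)
      then have "M a < n"
        using not_less_Least[of a "\<lambda>A. n \<le> M A"] by (simp add: A_def)
      then show ?thesis using B[of a] by (simp add: Suc vil_M_rec mult_le_mono)
    qed
  qed
qed

section \<open>Boundedness of the weighted maximal operator\<close>

text \<open>For each \<open>n\<close> the integral representation at a level with
  \<open>M A \<le> B * n\<close> is bounded by \<open>M A powr (1 - p)\<close> times an integral of
  \<open>p\<close>-th powers. The maximal function and \<open>vil_weight\<close> dominate that
  integrand independently of \<open>n\<close>, so the supremum is taken pointwise.\<close>

lemma weighted_maximal_powr_le:
  assumes f: "vil_martingale m f" and x: "x \<in> G" and p: "0 < p" "p < 1 / 2" and B: "\<And>k. m k \<le> B"
  shows "ennpowr (weighted_maximal m p f x) p \<le> ennreal (real B powr (1 - p)) *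
    (\<integral>\<^sup>+y. ennpowr (mart_maximal f y) p * vil_weight p x y \<partial>\<mu>)" (is "_ \<le> _ * ?H")
  unfolding weighted_maximal_def
proof (rule ennpowr_SUP_le[OF p(1)])
  fix n :: nat assume "n \<in> {1..}"
  then have n: "0 < n" by simp
  obtain A where A: "n \<le> M A" "M A \<le> B * n"
    using exists_M_between[OF B n] .
  define \<sigma> where "\<sigma> = norm (mart_sigma m n f x)"
  have int: "integrable \<mu> (f A)" using f by (simp add: vil_martingale_def)
  then have [measurable]: "f A \<in> borel_measurable \<mu>" by simp
  have level: "f A y = f A z" if "y \<in> G" "z \<in> G" "\<And>k. k < A \<Longrightarrow> y k = z k" for y z
  proof -
    \<comment> \<open>The martingale identity at equal indices: \<open>f A\<close> is a polynomial
      in characters below \<open>M A\<close>, hence sees only the first \<open>A\<close>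
      digits.\<close>
    have "f A y = vil_S m (M A) (f A) y" "f A z = vil_S m (M A) (f A) z"
      using f that by (auto simp: vil_martingale_def)
    moreover have "\<psi> i y = \<psi> i z" if "i < M A" for i
      using that \<open>\<And>k. k < A \<Longrightarrow> y k = z k\<close> by (rule vil_psi_cong)
    ultimately show ?thesis by (simp add: vil_S_def)
  qed
  have int_kernel: "integrable \<mu> (\<lambda>y. f A y * fejer_kernel n x y)"
    by (simp add: fejer_kernel_def sum_distrib_left integrable_mult_psi[OF int])
  have "real n * \<sigma> = norm (\<integral>y. f A y * fejer_kernel n x y \<partial>\<mu>)"
    unfolding mart_sigma_eq_integral[OF f n A(1), symmetric] by (simp add: \<sigma>_def norm_mult)
  then have I: "ennreal (real n * \<sigma>) \<le> (\<integral>\<^sup>+y. ennreal (norm (f A y * fejer_kernel n x y)) \<partial>\<mu>)"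
    using integral_norm_bound_ennreal[OF int_kernel] by simp
  have "ennreal ((real n * \<sigma>) powr p) \<le> ennreal (real (M A) powr (1 - p)) *
      (\<integral>\<^sup>+y. ennreal (norm (f A y * fejer_kernel n x y) powr p) \<partial>\<mu>)"
  proof (rule nn_integral_powr_le)
    fix y z assume "y \<in> G" "z \<in> G" "\<And>k. k < A \<Longrightarrow> y k = z k"
    then show "norm (f A y * fejer_kernel n x y) = norm (f A z * fejer_kernel n x z)"
      using level[of y z] fejer_kernel_cong[OF A(1), of y z x] by simp
  qed (use p I in \<open>auto simp: \<sigma>_def\<close>)
  also have "\<dots> \<le> ennreal (real (M A) powr (1 - p)) * ?H"
  proof (intro mult_left_mono nn_integral_mono)
    fix y assume "y \<in> space \<mu>"
    then have y: "y \<in> G" by (simp add: space_vil_measure)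
    have "ennreal (norm (f A y)) \<le> mart_maximal f y"
      unfolding mart_maximal_def by (rule SUP_upper) simp
    then have "ennreal (norm (f A y) powr p) \<le> ennpowr (mart_maximal f y) p"
      using ennpowr_mono[of p] p by (simp flip: ennpowr_ennreal)
    then have "ennreal (norm (f A y) powr p) * ennreal (norm (fejer_kernel n x y) powr p) \<le>
        ennpowr (mart_maximal f y) p * vil_weight p x y"
      using p by (intro mult_mono fejer_kernel_le_weight x y) auto
    then show "ennreal (norm (f A y * fejer_kernel n x y) powr p) \<le>
        ennpowr (mart_maximal f y) p * vil_weight p x y"
      by (simp add: norm_mult powr_mult ennreal_mult)
  qed simp
  finally have main: "ennreal ((real n * \<sigma>) powr p) \<le> ennreal (real (M A) powr (1 - p)) * ?H" .
  \<comment> \<open>The \<open>p\<close>-th power of the lowered weight is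
    \<open>n powr (1 - 2 * p)\<close>. Its inverse is \<open>n powr (p - 1) * n powr p\<close>: the
    second factor restores \<open>n * \<sigma>\<close>, the first compensates
    \<open>M A powr (1 - p)\<close>.\<close>
  have "(\<sigma> / (real n + 1) powr (1 / p - 2)) powr p \<le> (\<sigma> / real n powr (1 / p - 2)) powr p"
    using p n by (intro powr_mono2 divide_left_mono) (auto simp: \<sigma>_def field_simps)
  also have "\<dots> = real n powr (p - 1) * (real n * \<sigma>) powr p"
  proof -
    have "(\<sigma> / real n powr (1 / p - 2)) powr p = \<sigma> powr p * real n powr (- (1 - 2 * p))"
      using p n powr_minus_divide[of "real n" "1 - 2 * p"]
      by (simp add: powr_divide powr_powr left_diff_distrib \<sigma>_def)
    also have "- (1 - 2 * p) = (p - 1) + p" by simp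
    finally show ?thesis
      using n by (simp only: powr_add powr_mult of_nat_0_le_iff \<sigma>_def norm_ge_zero ac_simps)
  qed
  finally have "ennpowr (ennreal (\<sigma> / (real n + 1) powr (1 / p - 2))) p \<le>
      ennreal (real n powr (p - 1)) * ennreal ((real n * \<sigma>) powr p)"
    by (simp add: ennpowr_ennreal \<sigma>_def ennreal_mult[symmetric] ennreal_leI)
  also have "\<dots> \<le> ennreal (real n powr (p - 1)) * (ennreal (real (M A) powr (1 - p)) * ?H)"
    by (intro mult_left_mono main) simp
  also have "\<dots> = ennreal (real n powr (p - 1) * real (M A) powr (1 - p)) * ?H"
    by (simp add: ennreal_mult mult.assoc)
  also have "\<dots> \<le> ennreal (real B powr (1 - p)) * ?H"
  proof (intro mult_right_mono ennreal_leI)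
    have "real (M A) \<le> real B * real n"
      using A(2) by (metis of_nat_le_iff of_nat_mult)
    then have "real n powr (p - 1) * real (M A) powr (1 - p) \<le>
        real n powr (p - 1) * (real B * real n) powr (1 - p)"
      using p by (intro mult_left_mono powr_mono2) auto
    also have "\<dots> = real B powr (1 - p)"
      using n powr_add[of "real n" "p - 1" "1 - p"] by (simp add: powr_mult)
    finally show "real n powr (p - 1) * real (M A) powr (1 - p) \<le> real B powr (1 - p)" .
  qed simp
  finally show "ennpowr (ennreal (norm (mart_sigma m n f x) / (real n + 1) powr (1 / p - 2))) p
      \<le> ennreal (real B powr (1 - p)) * ?H"
    by (simp add: \<sigma>_def)
qed

lemma weighted_maximal_bounded:
  assumes p: "0 < p" "p < 1 / 2" and B: "\<And>k. m k \<le> B"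
  shows "bounded_hardy_to_lp m p (weighted_maximal m p)"
proof -
  obtain C where C: "0 < C" "\<And>y. y \<in> G \<Longrightarrow> (\<integral>\<^sup>+x. vil_weight p x y \<partial>\<mu>) \<le> ennreal C"
    using nn_integral_vil_weight[OF p B] by blast
  define K where "K = real B powr (1 - p) * C"
  have K: "0 < K" using C m_pos[of 0] B[of 0] by (simp add: K_def)
  have "lp_norm \<mu> p (weighted_maximal m p f) \<le> ennreal (K powr (1 / p)) * hardy_norm m p f"
    if f: "vil_martingale m f" for f
  proof -
    define F where "F y = ennpowr (mart_maximal f y) p" for y
    have [measurable]: "f n \<in> borel_measurable \<mu>" for n
      using f by (auto simp: vil_martingale_def dest: borel_measurable_integrable)
    have F [measurable]: "F \<in> borel_measurable \<mu>"
      unfolding F_def mart_maximal_def by measurable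
    have [measurable]: "(\<lambda>x. vil_weight p x y) \<in> borel_measurable \<mu>" if "y \<in> space \<mu>" for y
      using measurable_compose[OF measurable_Pair2'[OF that] measurable_vil_weight] by simp
    interpret pair_sigma_finite \<mu> \<mu> ..
    have "(\<integral>\<^sup>+x. ennpowr (weighted_maximal m p f x) p \<partial>\<mu>) \<le>
        (\<integral>\<^sup>+x. ennreal (real B powr (1 - p)) * (\<integral>\<^sup>+y. F y * vil_weight p x y \<partial>\<mu>) \<partial>\<mu>)"
      unfolding F_def using f p B
      by (intro nn_integral_mono weighted_maximal_powr_le) (auto simp: space_vil_measure)
    also have "\<dots> = ennreal (real B powr (1 - p)) * (\<integral>\<^sup>+x. (\<integral>\<^sup>+y. F y * vil_weight p x y \<partial>\<mu>) \<partial>\<mu>)"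
      by (intro nn_integral_cmult) (simp add: split_beta' borel_measurable_times_ennreal)
    \<comment> \<open>After the interchange \<open>F y\<close> leaves the inner integral, where
      \<open>C\<close> bounds the weight uniformly in \<open>y\<close>.\<close>
    also have "(\<integral>\<^sup>+x. (\<integral>\<^sup>+y. F y * vil_weight p x y \<partial>\<mu>) \<partial>\<mu>) =
        (\<integral>\<^sup>+y. (\<integral>\<^sup>+x. F y * vil_weight p x y \<partial>\<mu>) \<partial>\<mu>)"
      by (rule Fubini'[symmetric]) (simp add: split_beta')
    also have "\<dots> \<le> (\<integral>\<^sup>+y. ennreal C * F y \<partial>\<mu>)"
    proof (rule nn_integral_mono)
      fix y assume y: "y \<in> space \<mu>"
      then have "(\<integral>\<^sup>+x. F y * vil_weight p x y \<partial>\<mu>) = F y * (\<integral>\<^sup>+x. vil_weight p x y \<partial>\<mu>)"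
        by (intro nn_integral_cmult) simp
      also have "\<dots> \<le> F y * ennreal C"
        using y by (intro mult_left_mono C) (auto simp: space_vil_measure)
      finally show "(\<integral>\<^sup>+x. F y * vil_weight p x y \<partial>\<mu>) \<le> ennreal C * F y"
        by (simp add: mult.commute)
    qed
    also have "\<dots> = ennreal C * (\<integral>\<^sup>+y. F y \<partial>\<mu>)"
      by (rule nn_integral_cmult[OF F])
    finally have "(\<integral>\<^sup>+x. ennpowr (weighted_maximal m p f x) p \<partial>\<mu>) \<le> ennreal K * (\<integral>\<^sup>+y. F y \<partial>\<mu>)"
      using C(1) by (simp add: K_def ennreal_mult mult_left_mono mult.assoc)
    then have "lp_norm \<mu> p (weighted_maximal m p f) \<le> ennpowr (ennreal K * (\<integral>\<^sup>+y. F y \<partial>\<mu>)) (1 / p)"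
      unfolding lp_norm_def using p by (intro ennpowr_mono) auto
    also have "\<dots> = ennreal (K powr (1 / p)) * hardy_norm m p f"
      unfolding hardy_norm_def lp_norm_def F_def using p K by (intro ennpowr_mult_ennreal) auto
    finally show ?thesis .
  qed
  then show ?thesis
    unfolding bounded_hardy_to_lp_def hardy_space_def by (intro exI[of _ "K powr (1 / p)"]) auto
qed

section \<open>Sharpness of the weight\<close>

text \<open>The function \<open>f_k\<close> of the theorem, with \<open>N\<close> for
  \<open>2 * n_k\<close>.\<close>

definition dirichlet_diff :: "nat \<Rightarrow> (nat \<Rightarrow> nat) \<Rightarrow> complex" where
  "dirichlet_diff N x = vil_D m (M (N + 1)) x - vil_D m (M N) x"

lemma M_less_Suc: "M N < M (N + 1)"
  using m_ge[of N] M_pos[of N] by (simp add: vil_M_rec)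

lemma dirichlet_diff_eq:
  "dirichlet_diff N x = (\<Sum>i<M (N + 1). (if i < M N then 0 else 1) * \<psi> i x)"
proof -
  have "(\<Sum>i<M (N + 1). (if i < M N then 1 else 0) * \<psi> i x) = (\<Sum>i<M N. \<psi> i x)"
    using M_less_Suc[of N] by (intro sum.mono_neutral_cong_right) auto
  then have "dirichlet_diff N x =
      (\<Sum>i<M (N + 1). \<psi> i x) - (\<Sum>i<M (N + 1). (if i < M N then 1 else 0) * \<psi> i x)"
    by (simp add: dirichlet_diff_def vil_D_def)
  also have "\<dots> = (\<Sum>i<M (N + 1). (if i < M N then 0 else 1) * \<psi> i x)"
    by (simp only: sum_subtractf[symmetric]) (intro sum.cong, auto)
  finally show ?thesis .
qed

lemma vil_coeff_dirichlet_diff: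
  "vil_coeff m (dirichlet_diff N) i = (if M N \<le> i \<and> i < M (N + 1) then 1 else 0)"
  unfolding dirichlet_diff_eq[abs_def] vil_coeff_sum by auto

text \<open>The spectrum lies in \<open>{M N..<M (N + 1)}\<close> and no \<open>M n\<close> falls
  strictly inside, so truncation at \<open>M n\<close> removes all of it or nothing.\<close>

lemma martingale_of_dirichlet_diff:
  "martingale_of m (dirichlet_diff N) n x = (if n \<le> N then 0 else dirichlet_diff N x)"
proof (cases "n \<le> N")
  case True
  then have "M n \<le> M N" by (rule M_mono)
  then show ?thesis
    using True by (auto simp: martingale_of_def vil_S_def vil_coeff_dirichlet_diff intro!: sum.neutral)
next
  case False
  then have "M (N + 1) \<le> M n" by (intro M_mono) simp
  then have "vil_S m (M n) (dirichlet_diff N) x = dirichlet_diff N x"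
    unfolding vil_S_def vil_coeff_dirichlet_diff dirichlet_diff_eq
    by (intro sum.mono_neutral_cong_right) auto
  then show ?thesis using False by (simp add: martingale_of_def)
qed

text \<open>Of the first \<open>M N + 1\<close> partial sums only the last is nonzero, and it
  contains just the lowest frequency \<open>M N\<close>.\<close>

lemma mart_sigma_dirichlet_diff:
  "mart_sigma m (M N + 1) (martingale_of m (dirichlet_diff N)) x = \<psi> (M N) x / of_nat (M N + 1)"
proof -
  let ?c = "\<lambda>i. if M N \<le> i \<and> i < M (N + 1) then 1 else 0"
  have coeff: "mart_coeff m (martingale_of m (dirichlet_diff N)) i = ?c i" for i
  proof (rule mart_coeffI)
    fix n assume "N + 1 \<le> n"
    then show "vil_coeff m (martingale_of m (dirichlet_diff N) n) i = ?c i"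
      by (simp add: martingale_of_dirichlet_diff[abs_def] vil_coeff_dirichlet_diff)
  qed
  have "mart_S m k (martingale_of m (dirichlet_diff N)) x = 0" if "k \<le> M N" for k
    using that by (auto simp: mart_S_def coeff intro!: sum.neutral)
  moreover have "mart_S m (Suc (M N)) (martingale_of m (dirichlet_diff N)) x = \<psi> (M N) x"
  proof -
    have "mart_S m (Suc (M N)) (martingale_of m (dirichlet_diff N)) x =
        (\<Sum>i<M N. ?c i * \<psi> i x) + ?c (M N) * \<psi> (M N) x"
      by (simp add: mart_S_def coeff)
    also have "(\<Sum>i<M N. ?c i * \<psi> i x) = 0" by (rule sum.neutral) auto
    finally show ?thesis using M_less_Suc[of N] by simp
  qed
  ultimately show ?thesis
    by (simp add: mart_sigma_def)
qed

lemma dirichlet_diff_eq_0: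
  assumes "x \<in> G" "s < N" "x s \<noteq> 0"
  shows "dirichlet_diff N x = 0"
proof -
  have zero: "(\<lambda>_. 0) \<in> G" using m_pos by (auto simp: vil_group_def)
  have "vil_r m s x \<noteq> 1"
    using vil_r_eq_iff[OF assms(1) zero, of s] assms(3) by (auto simp: vil_r_def)
  then have "vil_D m (M a) x = 0" if "N \<le> a" for a
    unfolding vil_D_def vil_psi_eq_char using assms that by (intro sum_vil_char_M_eq_0[of s]) auto
  then show ?thesis by (simp add: dirichlet_diff_def)
qed

lemma norm_dirichlet_diff_le: "norm (dirichlet_diff N x) \<le> real (M (N + 1))"
proof -
  have "norm (dirichlet_diff N x) \<le> (\<Sum>i<M (N + 1). 1)"
    unfolding dirichlet_diff_eq by (rule sum_norm_le) simp
  then show ?thesis by simp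
qed

text \<open>The maximal function is at most \<open>M (N + 1)\<close> on the rank \<open>N\<close>
  cylinder of the origin, whose measure is \<open>1 / M N\<close>, and vanishes off it.\<close>

lemma hardy_norm_dirichlet_diff_le:
  assumes p: "0 < p"
  shows "hardy_norm m p (martingale_of m (dirichlet_diff N)) \<le>
    ennreal (real (M (N + 1)) * (1 / real (M N)) powr (1 / p))"
proof -
  let ?f = "martingale_of m (dirichlet_diff N)"
  let ?A = "{x \<in> G. \<forall>j\<in>{..<N}. x j = 0}"
  have zero: "(\<lambda>_. 0) \<in> G" using m_pos by (auto simp: vil_group_def)
  have [measurable]: "?A \<in> sets \<mu>"
    unfolding space_vil_measure[symmetric] by measurable
  have A: "emeasure \<mu> ?A = ennreal (1 / real (M N))"
    using emeasure_vil_agree[OF _ zero, of "{..<N}"] by (simp add: vil_M_def prod_dividef)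
  have le: "ennpowr (mart_maximal ?f x) p \<le> ennreal (real (M (N + 1)) powr p) * indicator ?A x"
    if x: "x \<in> G" for x
    unfolding mart_maximal_def
  proof (rule ennpowr_SUP_le[OF p])
    fix n
    show "ennpowr (ennreal (norm (?f n x))) p \<le> ennreal (real (M (N + 1)) powr p) * indicator ?A x"
    proof (cases "x \<in> ?A")
      case True
      have "norm (?f n x) \<le> real (M (N + 1))"
        using norm_dirichlet_diff_le[of N x] by (auto simp: martingale_of_dirichlet_diff)
      then show ?thesis
        using True p by (auto simp: ennpowr_ennreal intro!: ennreal_leI powr_mono2)
    next
      case False
      then obtain s where "s < N" "x s \<noteq> 0" using x by auto
      then have "?f n x = 0"
        using dirichlet_diff_eq_0[OF x] by (simp add: martingale_of_dirichlet_diff)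
      then show ?thesis by (simp add: ennpowr_def)
    qed
  qed
  have "(\<integral>\<^sup>+x. ennpowr (mart_maximal ?f x) p \<partial>\<mu>) \<le>
      (\<integral>\<^sup>+x. ennreal (real (M (N + 1)) powr p) * indicator ?A x \<partial>\<mu>)"
    by (intro nn_integral_mono le) (simp add: space_vil_measure)
  also have "\<dots> = ennreal (real (M (N + 1)) powr p * (1 / real (M N)))"
    using A by (simp add: nn_integral_cmult_indicator ennreal_mult[symmetric])
  finally have "hardy_norm m p ?f \<le> ennpowr (ennreal (real (M (N + 1)) powr p * (1 / real (M N)))) (1 / p)"
    unfolding hardy_norm_def lp_norm_def using p by (intro ennpowr_mono) auto
  also have "\<dots> = ennreal ((real (M (N + 1)) powr p * (1 / real (M N))) powr (1 / p))"
    by (rule ennpowr_ennreal) simp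
  also have "(real (M (N + 1)) powr p * (1 / real (M N))) powr (1 / p) =
      real (M (N + 1)) * (1 / real (M N)) powr (1 / p)"
    using p by (subst powr_mult) (simp_all add: powr_powr)
  finally show ?thesis .
qed

lemma weak_lp_norm_const_ge:
  assumes p: "0 < p" and a: "0 < a" and g: "\<And>x. norm (g x) = a"
  shows "ennreal (a / 2) \<le> weak_lp_norm \<mu> p g"
proof -
  \<comment> \<open>The inequality is strict, so the level must stay below \<open>a\<close>; at
    \<open>a / 2\<close> the set is the whole space, of measure 1.\<close>
  have "{x \<in> space \<mu>. a / 2 < norm (g x)} = space \<mu>"
    using a g by auto
  then have "ennreal (a / 2) * ennpowr (emeasure \<mu> {x \<in> space \<mu>. a / 2 < norm (g x)}) (1 / p) =
      ennreal (a / 2)"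
    using ennpowr_ennreal[of 1 "1 / p"] by (simp add: emeasure_space_1)
  then show ?thesis
    unfolding weak_lp_norm_def using a by (intro SUP_upper2[of "a / 2"]) auto
qed

text \<open>The constant \<open>4 * B\<close> combines 2 from the level \<open>a / 2\<close>, 2 from
  \<open>M N + 1 \<le> 2 * M N\<close> and \<open>B\<close> from
  \<open>M (N + 1) \<le> B * M N\<close>.\<close>

lemma weak_lp_hardy_ratio_ge:
  assumes p: "0 < p" and B: "\<And>k. m k \<le> B" and c: "0 < c"
  shows "ennreal (real (M N) powr (1 / p - 2) / (4 * real B * c)) \<le>
    weak_lp_norm \<mu> p (\<lambda>x. mart_sigma m (M N + 1) (martingale_of m (dirichlet_diff N)) x / of_real c)
      / hardy_norm m p (martingale_of m (dirichlet_diff N))"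
proof -
  define a where "a = 1 / (real (M N + 1) * c)"
  define h where "h = real (M (N + 1)) * (1 / real (M N)) powr (1 / p)"
  have a: "0 < a" using c by (simp add: a_def)
  have MN: "1 \<le> real (M N)" using M_pos[of N] by simp
  have B0: "1 \<le> real B" using m_pos[of 0] B[of 0] by simp
  have h: "0 < h" using MN M_pos[of "N + 1"] by (simp add: h_def)
  have weak: "ennreal (a / 2) \<le>
      weak_lp_norm \<mu> p (\<lambda>x. mart_sigma m (M N + 1) (martingale_of m (dirichlet_diff N)) x / of_real c)"
  proof (rule weak_lp_norm_const_ge[OF p a])
    fix x
    have "norm (of_nat (M N + 1) :: complex) = real (M N + 1)" by (rule norm_of_nat)
    then show "norm (mart_sigma m (M N + 1) (martingale_of m (dirichlet_diff N)) x / of_real c) = a"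
      unfolding mart_sigma_dirichlet_diff norm_divide norm_vil_psi a_def using c by simp
  qed
  have "real (M N) powr (1 / p - 2) / (4 * real B * c) \<le> a / 2 / h"
  proof -
    have "h \<le> real B * real (M N) * (1 / real (M N)) powr (1 / p)"
      unfolding h_def using B[of N] by (intro mult_right_mono) (auto simp: vil_M_rec mult_right_mono)
    also have "\<dots> = real B * real (M N) / real (M N) powr (1 / p)"
      using MN by (simp add: powr_divide)
    finally have h_le: "h \<le> real B * real (M N) / real (M N) powr (1 / p)" .
    have a_ge: "1 / (2 * real (M N) * c) \<le> a"
      unfolding a_def using MN c by (intro divide_left_mono) auto
    have "real (M N) powr (1 / p - 2) = real (M N) powr (1 / p) / (real (M N) * real (M N))"
      using MN by (simp add: powr_diff power2_eq_square[symmetric])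
    then have "real (M N) powr (1 / p - 2) / (4 * real B * c) =
        1 / (2 * real (M N) * c) / 2 / (real B * real (M N) / real (M N) powr (1 / p))"
      by simp
    also have "\<dots> \<le> a / 2 / h"
      using a_ge h_le h a MN B0 c by (intro frac_le divide_right_mono) auto
    finally show ?thesis .
  qed
  then have "ennreal (real (M N) powr (1 / p - 2) / (4 * real B * c)) \<le> ennreal (a / 2) / ennreal h"
    using a h by (simp add: divide_ennreal ennreal_leI)
  also have "\<dots> \<le> weak_lp_norm \<mu> p (\<lambda>x. mart_sigma m (M N + 1) (martingale_of m (dirichlet_diff N)) x / of_real c)
      / ennreal h"
    by (rule divide_right_mono_ennreal[OF weak])
  also have "\<dots> \<le> weak_lp_norm \<mu> p (\<lambda>x. mart_sigma m (M N + 1) (martingale_of m (dirichlet_diff N)) x / of_real c)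
      / hardy_norm m p (martingale_of m (dirichlet_diff N))"
    using hardy_norm_dirichlet_diff_le[OF p, of N] unfolding h_def[symmetric] divide_ennreal_def
    by (intro mult_left_mono inverse_antimono_ennreal) auto
  finally show ?thesis .
qed

text \<open>The limit superior supplies some large \<open>n\<close>, not one of the required form.
  With \<open>M (2 * \<nu>) < n \<le> M (2 * \<nu> + 2)\<close> the numerator at \<open>n\<close>
  exceeds that at \<open>M (2 * \<nu>)\<close> by at most the factor \<open>R\<close>, while
  monotonicity gives \<open>\<Phi> (M (2 * \<nu>) + 1) \<le> \<Phi> n\<close>.\<close>

lemma exists_large_ratio:
  assumes p: "0 < p" "p < 1 / 2" and B: "\<And>k. m k \<le> B"
    and \<Phi>: "\<And>n. 0 < \<Phi> n" "mono \<Phi>"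
    and lim: "limsup (\<lambda>n. ereal ((real n + 1) powr (1 / p - 2) / \<Phi> n)) = \<infinity>"
  shows "\<exists>\<nu>>0. K \<le> real (M (2 * \<nu>)) powr (1 / p - 2) / \<Phi> (M (2 * \<nu>) + 1)"
proof -
  define e where "e = 1 / p - 2"
  have e: "0 < e" using p by (simp add: e_def field_simps)
  have B0: "1 \<le> real B" using m_pos[of 0] B[of 0] by simp
  \<comment> \<open>From \<open>n + 1 \<le> 2 * B^2 * M (2 * \<nu>)\<close>: two digits cost
    \<open>B^2\<close>, and the 2 absorbs the added 1.\<close>
  define R where "R = (2 * real B ^ 2) powr e"
  have R: "0 < R" using B0 by (simp add: R_def)
  \<comment> \<open>Requiring \<open>n > M 2\<close> excludes \<open>\<nu> = 0\<close> below, as the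
    index must be positive.\<close>
  have "\<exists>n>M 2. K * R < (real n + 1) powr e / \<Phi> n"
  proof (rule ccontr)
    assume "\<not> ?thesis"
    then have "ereal ((real n + 1) powr e / \<Phi> n) \<le> ereal (K * R)" if "M 2 < n" for n
      using that by (metis ereal_less_eq(3) not_less)
    then have "eventually (\<lambda>n. ereal ((real n + 1) powr e / \<Phi> n) \<le> ereal (K * R)) sequentially"
      using eventually_gt_at_top[of "M 2"] by (rule eventually_mono[rotated])
    then have "limsup (\<lambda>n. ereal ((real n + 1) powr e / \<Phi> n)) \<le> ereal (K * R)"
      by (rule Limsup_bounded)
    then show False using lim by (simp add: e_def)
  qed
  then obtain n where n: "M 2 < n" "K * R < (real n + 1) powr e / \<Phi> n" by blast
  define \<nu> where "\<nu> = (LEAST j. n \<le> M (2 * (j + 1)))"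
  have upper: "n \<le> M (2 * (\<nu> + 1))"
    unfolding \<nu>_def
  proof (rule LeastI)
    show "n \<le> M (2 * (n + 1))" using less_M[of "2 * (n + 1)"] by simp
  qed
  have "\<nu> \<noteq> 0"
  proof
    assume "\<nu> = 0"
    then show False using upper n(1) by simp
  qed
  then have "\<nu> - 1 < (LEAST j. n \<le> M (2 * (j + 1)))" by (simp only: \<nu>_def)
  from not_less_Least[OF this] have lower: "M (2 * \<nu>) < n"
    using \<open>\<nu> \<noteq> 0\<close> by (simp add: not_le)
  have M0: "1 \<le> real (M (2 * \<nu>))" using M_pos[of "2 * \<nu>"] by simp
  have "M (2 * (\<nu> + 1)) = m (Suc (2 * \<nu>)) * (m (2 * \<nu>) * M (2 * \<nu>))"
    by (simp add: vil_M_rec)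
  also have "\<dots> \<le> B * (B * M (2 * \<nu>))"
    using B by (intro mult_le_mono) auto
  finally have "n \<le> B * (B * M (2 * \<nu>))" using upper by linarith
  then have "real n \<le> real (B * (B * M (2 * \<nu>)))" by (simp only: of_nat_le_iff)
  then have "real n \<le> real B ^ 2 * real (M (2 * \<nu>))" by (simp add: power2_eq_square mult.assoc)
  moreover have "1 \<le> real B ^ 2 * real (M (2 * \<nu>))"
    using mult_mono[of 1 "real B ^ 2" 1 "real (M (2 * \<nu>))"] B0 M0 by (simp add: one_le_power)
  ultimately have "real n + 1 \<le> 2 * real B ^ 2 * real (M (2 * \<nu>))" by simp
  then have "(real n + 1) powr e \<le> (2 * real B ^ 2 * real (M (2 * \<nu>))) powr e"
    using e by (intro powr_mono2) auto
  also have "\<dots> = R * real (M (2 * \<nu>)) powr e"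
    by (simp add: R_def powr_mult)
  finally have num: "(real n + 1) powr e \<le> R * real (M (2 * \<nu>)) powr e" .
  have "\<Phi> (M (2 * \<nu>) + 1) \<le> \<Phi> n"
    using lower by (intro monoD[OF \<Phi>(2)]) simp
  then have "(real n + 1) powr e / \<Phi> n \<le> R * real (M (2 * \<nu>)) powr e / \<Phi> (M (2 * \<nu>) + 1)"
    using num \<Phi>(1) R by (intro frac_le) auto
  with n(2) have "K * R < R * (real (M (2 * \<nu>)) powr e / \<Phi> (M (2 * \<nu>) + 1))" by simp
  then have "K < real (M (2 * \<nu>)) powr e / \<Phi> (M (2 * \<nu>) + 1)"
    using R by (simp only: mult.commute[of K] mult_less_cancel_left_pos)
  then show ?thesis using \<open>\<nu> \<noteq> 0\<close> by (intro exI[of _ \<nu>]) (simp add: e_def)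
qed

lemma exists_unbounded_ratio:
  assumes p: "0 < p" "p < 1 / 2" and B: "\<And>k. m k \<le> B"
    and \<Phi>: "\<And>n. 0 < \<Phi> n" "mono \<Phi>"
    and lim: "limsup (\<lambda>n. ereal ((real n + 1) powr (1 / p - 2) / \<Phi> n)) = \<infinity>"
  shows "\<exists>\<nu> :: nat \<Rightarrow> nat. (\<forall>k. 0 < \<nu> k) \<and>
    (SUP k. weak_lp_norm \<mu> p
      (\<lambda>x. mart_sigma m (M (2 * \<nu> k) + 1) (martingale_of m (dirichlet_diff (2 * \<nu> k))) x
        / of_real (\<Phi> (M (2 * \<nu> k) + 1)))
      / hardy_norm m p (martingale_of m (dirichlet_diff (2 * \<nu> k)))) = \<top>"
proof -
  have B0: "0 < real B" using m_pos[of 0] B[of 0] by simp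
  \<comment> \<open>The threshold cancels the constant \<open>4 * B\<close> of
    \<open>weak_lp_hardy_ratio_ge\<close>, so the \<open>k\<close>-th quotient is at least
    \<open>k\<close>.\<close>
  have "\<forall>k. \<exists>\<nu>>0. 4 * real B * real k \<le> real (M (2 * \<nu>)) powr (1 / p - 2) / \<Phi> (M (2 * \<nu>) + 1)"
    using exists_large_ratio[OF p B \<Phi> lim] by blast
  then obtain \<nu> where \<nu>: "\<And>k. 0 < \<nu> k"
    "\<And>k. 4 * real B * real k \<le> real (M (2 * \<nu> k)) powr (1 / p - 2) / \<Phi> (M (2 * \<nu> k) + 1)"
    by metis
  have ge: "ennreal (real k) \<le>
      ennreal (real (M (2 * \<nu> k)) powr (1 / p - 2) / (4 * real B * \<Phi> (M (2 * \<nu> k) + 1)))" for k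
    using \<nu>(2)[of k] B0 \<Phi>(1) by (intro ennreal_leI) (simp add: field_simps)
  show ?thesis
    using \<nu>(1) order_trans[OF ge weak_lp_hardy_ratio_ge[OF p(1) B \<Phi>(1)]]
    by (intro exI[of _ \<nu>] conjI allI ennreal_SUP_eq_top)
      (auto simp: ennreal_of_nat_eq_real_of_nat)
qed

end

theorem theorem3p4:
  fixes m :: "nat \<Rightarrow> nat" and p :: real
  assumes m_ge: "\<And>k. 2 \<le> m k"
    and m_bounded: "\<exists>B. \<forall>k. m k \<le> B"
    and p: "0 < p" "p < 1 / 2"
  shows "bounded_hardy_to_lp m p (weighted_maximal m p) \<and>
    (\<forall>\<Phi> :: nat \<Rightarrow> real.
       (\<forall>n. 0 < \<Phi> n) \<longrightarrow> mono \<Phi> \<longrightarrow>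
       limsup (\<lambda>n. ereal ((real n + 1) powr (1 / p - 2) / \<Phi> n)) = \<infinity> \<longrightarrow>
       (\<exists>\<nu> :: nat \<Rightarrow> nat. (\<forall>k. 0 < \<nu> k) \<and>
          (let f = (\<lambda>k. martingale_of m
                 (\<lambda>x. vil_D m (vil_M m (2 * \<nu> k + 1)) x - vil_D m (vil_M m (2 * \<nu> k)) x))
           in (SUP k. weak_lp_norm (vil_measure m) p
                   (\<lambda>x. mart_sigma m (vil_M m (2 * \<nu> k) + 1) (f k) x
                        / of_real (\<Phi> (vil_M m (2 * \<nu> k) + 1)))
                 / hardy_norm m p (f k)) = \<top>)))"
proof -
  interpret vilenkin m by unfold_locales (rule m_ge)
  obtain B where B: "\<And>k. m k \<le> B" using m_bounded by blast
  show ?thesis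
    unfolding Let_def
    using weighted_maximal_bounded[OF p B] exists_unbounded_ratio[OF p B]
    by (auto simp: dirichlet_diff_def[abs_def])
qed

end
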